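(* Let $\delta$ be an associative algebra structure on $W$ and $\mu$ an associative algebra structure on $M$. The infinitesimal extensions of $\delta$ by $\mu$, up to infinitesimal equivalence, are completely classified by the cohomology classes $\bar\lambda\in H^{1,1}_\mu$ which satisfy $$\overline{[\delta,\lambda]}=0\in H^{1,2}_{\mu}(\ker(D_\delta))$$ together with the cohomology classes $[\bar\tau]\in H^{0,2}_{\mu,\delta}$. That is: (i) the class $\bar\lambda$ of an infinitesimal extension $\delta+\mu+t(\lambda+\psi)$ depends only on its infinitesimal equivalence class, and a class $\bar\lambda\in H^{1,1}_\mu$ arises in this way if and only if it satisfies the displayed condition (which is independent of the representative $\lambda$); (ii) for each such class, fixing a representative $\lambda$ and one $\psi$ such that $\delta+\mu+t(\lambda+\psi)$ is an infinitesimal extension, the map $[\bar\tau]\mapsto \delta+\mu+t(\lambda+\psi+\tau)$ induces a bijection from $H^{0,2}_{\mu,\delta}$ to the set of infinitesimal equivalence classes of infinitesimal extensions with class $\bar\lambda$.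
   Context: Work over a field $\mathbb K$ of characteristic different from 2 and 3. $M,W$ are $\mathbb Z_2$-graded vector spaces and $V=M\oplus W$ (parity-reversed convention: an ordinary ungraded algebra corresponds to a completely odd space). Let $C(V)=\operatorname{Hom}(T(V),V)$, $T(V)=\bigoplus_n V^{\otimes n}$. For $\varphi\in\operatorname{Hom}(V^{\otimes k},V)$ and $\chi\in\operatorname{Hom}(V^{\otimes l},V)$ put $$(\varphi\circ\chi)(v_1,\dots,v_{k+l-1})=\sum_i(-1)^{|\chi|(|v_1|+\dots+|v_{i-1}|)}\varphi(v_1,\dots,v_{i-1},\chi(v_i,\dots,v_{i+l-1}),\dots,v_{k+l-1}),$$ and $[\varphi,\chi]=\varphi\circ\chi-(-1)^{|\varphi||\chi|}\chi\circ\varphi$ (the graded Lie bracket of coderivations of $T(V)$). Maps defined on a summand of $T(V)$ are extended by zero. An odd $d\in\operatorname{Hom}(V^{\otimes2},V)$ is an associative algebra structure iff $[d,d]=0$. Let $T^{k,l}(M,W)\subseteq V^{\otimes(k+l)}$ be spanned by tensors of $k$ elements of $M$ and $l$ elements of $W$ in any order, $C^{k,l}=\operatorname{Hom}(T^{k,l}(M,W),M)$, and $C^k=\operatorname{Hom}(W^{\otimes k},W)$. Thus $\delta\in C^2$, $\mu\in C^{2,0}$ are odd with $[\delta,\delta]=[\mu,\mu]=0$. An infinitesimal extension of $\delta$ by $\mu$ is $d=\delta+\mu+t(\lambda+\psi)$ with $t^2=0$, $\lambda\in C^{1,1}$ and $\psi\in C^{0,2}$ odd, and $[d,d]=0$;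 equivalently $[\delta,\lambda]+[\mu,\psi]=0$, $[\mu,\lambda]=0$, $[\delta,\psi]=0$. Two infinitesimal extensions $d,d'$ are infinitesimally equivalent if $d'=\exp(t\beta)^*(d)$ for some even $\beta\in C^{0,1}=\operatorname{Hom}(W,M)$, where $f^*(d)=f^{-1}\circ d\circ(f\otimes f)$; explicitly $\lambda'=\lambda+[\mu,\beta]$, $\psi'=\psi+[\delta,\beta]$. For $\alpha\in C(V)$ put $D_\alpha=[\alpha,\cdot\,]$. Then $D_\mu:C^{k,l}\to C^{k+1,l}$ and $D_\delta:C^{k,l}\to C^{k,l+1}$ square to zero and anticommute. - $H_\mu^{k,l}=\ker(D_\mu|_{C^{k,l}})/D_\mu(C^{k-1,l})$ (with $C^{-1,l}=0$); the class of $\varphi$ is $\bar\varphi$. - $H_\mu^{1,2}(\ker(D_\delta))=\{\varphi\in C^{1,2}:D_\mu\varphi=0,\,D_\delta\varphi=0\}/D_\mu\{\psi\in C^{0,2}:D_\delta\psi=0\}$. - $D_{\bar\delta}:H_\mu^{k,l}\to H_\mu^{k,l+1}$, $\bar\varphi\mapsto\overline{[\delta,\varphi]}$, squares to zero, and $H_{\mu,\delta}^{0,2}=\ker(D_{\bar\delta}:H^{0,2}_\mu\to H_\mu^{0,3})/D_{\bar\delta}(H_\mu^{0,1})$; the class of $\bar\tau$ is $[\bar\tau]$. Convention: in $H_\mu^{1,1}$ and $H_{\mu,\delta}^{0,2}$ only classes of odd cochains are considered (automatic when $V$ is completely odd). *)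

theory Defs
  imports
    "HOL-Library.Z2"
    "HOL-Library.Set_Algebras"
    "HOL-Library.Function_Algebras"
    "HOL-Library.Product_Plus"
    "HOL-Computational_Algebra.Computational_Algebra"
begin

text \<open>Parities are elements of \<^typ>\<open>bit\<close>, the field with two elements; \<open>1\<close> is the odd parity.
  A grading of \<open>V\<close> is the family \<open>G p\<close> of its homogeneous parts.  The space \<open>V\<close> is an
  arbitrary vector space carried by a whole type; \<open>M\<close> and \<open>W\<close> are given by their homogeneous
  parts inside \<open>V\<close>, and \<open>V\<close> is the internal direct sum of the four pieces.\<close>

definition total :: "(bit \<Rightarrow> 'v::ab_group_add set) \<Rightarrow> 'v set" where
  "total M = M 0 + M 1"

definition graded_sum ::
  "('k::field \<Rightarrow> 'v::ab_group_add \<Rightarrow> 'v) \<Rightarrow> (bit \<Rightarrow> 'v set) \<Rightarrow> (bit \<Rightarrow> 'v set) \<Rightarrow> bool" where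
  "graded_sum scale M W \<longleftrightarrow>
     vector_space scale \<and>
     (\<forall>p. module.subspace scale (M p) \<and> module.subspace scale (W p)) \<and>
     (\<forall>v. \<exists>!(a, b, c, e). a \<in> M 0 \<and> b \<in> M 1 \<and> c \<in> W 0 \<and> e \<in> W 1 \<and> v = a + b + c + e)"

definition grade :: "(bit \<Rightarrow> 'v::ab_group_add set) \<Rightarrow> (bit \<Rightarrow> 'v set) \<Rightarrow> bit \<Rightarrow> 'v set" where
  "grade M W p = M p + W p"

definition component :: "(bit \<Rightarrow> 'v::ab_group_add set) \<Rightarrow> bit \<Rightarrow> 'v \<Rightarrow> 'v" where
  "component G p v = (THE a. a \<in> G p \<and> (\<exists>b\<in>G (p + 1). v = a + b))"


text \<open>A linear map \<open>T(V) \<rightarrow> V\<close> is a family of multilinear maps \<open>V^n \<rightarrow> V\<close>, encoded as one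
  function on lists whose restriction to lists of length \<open>n\<close> is the \<open>n\<close>-th member.  The list
  \<open>[v1, ..., vn]\<close> stands for the tensor \<open>v1 \<otimes> ... \<otimes> vn\<close>.\<close>

type_synonym 'v cochain = "'v list \<Rightarrow> 'v"

definition multilinear :: "('k::field \<Rightarrow> 'v::ab_group_add \<Rightarrow> 'v) \<Rightarrow> 'v cochain \<Rightarrow> bool" where
  "multilinear scale \<phi> \<longleftrightarrow>
     (\<forall>us ws. Vector_Spaces.linear scale scale (\<lambda>v. \<phi> (us @ v # ws)))"

definition has_parity :: "(bit \<Rightarrow> 'v::ab_group_add set) \<Rightarrow> bit \<Rightarrow> 'v cochain \<Rightarrow> bool" where
  "has_parity G q \<phi> \<longleftrightarrow>
     (\<forall>ps vs. list_all2 (\<lambda>p v. v \<in> G p) ps vs \<longrightarrow> \<phi> vs \<in> G (q + sum_list ps))"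

definition parity_part ::
  "(bit \<Rightarrow> 'v::ab_group_add set) \<Rightarrow> bit \<Rightarrow> 'v cochain \<Rightarrow> 'v cochain" where
  "parity_part G q \<phi> vs =
     (\<Sum>ps\<in>{ps. length ps = length vs}.
        component G (q + sum_list ps) (\<phi> (map2 (component G) ps vs)))"

definition sign :: "bit \<Rightarrow> 'v::ab_group_add \<Rightarrow> 'v" where
  "sign p v = (if p = 0 then v else - v)"

text \<open>\<open>koszul G q\<close> is the linear map sending a homogeneous \<open>v\<close> to \<open>(-1)^(q |v|) v\<close>.  Applied to
  each argument to the left of \<open>\<chi>\<close>, it produces the sign in \<open>\<phi> \<circ> \<chi>\<close> for \<open>\<chi>\<close> of parity \<open>q\<close>.\<close>

definition koszul :: "(bit \<Rightarrow> 'v::ab_group_add set) \<Rightarrow> bit \<Rightarrow> 'v \<Rightarrow> 'v" where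
  "koszul G q v = (\<Sum>p\<in>{0, 1}. sign (q * p) (component G p v))"

text \<open>The product \<open>\<phi> \<circ> \<chi>\<close> for \<open>\<chi>\<close> of parity \<open>q\<close>; \<open>i\<close> is the number of arguments in front
  of \<open>\<chi>\<close> and \<open>l\<close> the arity of the component of \<open>\<chi>\<close> used.\<close>

definition circ ::
  "(bit \<Rightarrow> 'v::ab_group_add set) \<Rightarrow> bit \<Rightarrow> 'v cochain \<Rightarrow> 'v cochain \<Rightarrow> 'v cochain" where
  "circ G q \<phi> \<chi> vs =
     (\<Sum>i\<in>{0..length vs}. \<Sum>l\<in>{0..length vs - i}.
        \<phi> (map (koszul G q) (take i vs) @ [\<chi> (take l (drop i vs))] @ drop (i + l) vs))"

text \<open>The bracket is given on homogeneous elements and extended biadditively.\<close>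

definition bracket ::
  "(bit \<Rightarrow> 'v::ab_group_add set) \<Rightarrow> 'v cochain \<Rightarrow> 'v cochain \<Rightarrow> 'v cochain" where
  "bracket G \<phi> \<chi> vs =
     (\<Sum>p\<in>{0, 1}. \<Sum>q\<in>{0, 1}.
        circ G q (parity_part G p \<phi>) (parity_part G q \<chi>) vs
        - sign (p * q) (circ G p (parity_part G q \<chi>) (parity_part G p \<phi>) vs))"


text \<open>Lists of \<open>k\<close> elements of \<open>M\<close> and \<open>l\<close> elements of \<open>W\<close> in any order: the tensors
  spanning \<open>T^{k,l}(M,W)\<close>.\<close>

definition tensors :: "(bit \<Rightarrow> 'v::ab_group_add set) \<Rightarrow> (bit \<Rightarrow> 'v set) \<Rightarrow> nat \<Rightarrow> nat \<Rightarrow> 'v list set" where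
  "tensors M W k l =
     (\<Union>ms\<in>{ms. length ms = k \<and> set ms \<subseteq> total M}.
      \<Union>ws\<in>{ws. length ws = l \<and> set ws \<subseteq> total W}. shuffles ms ws)"

text \<open>\<open>Hom(T^{k,l}(M,W), N)\<close> for a subspace \<open>N\<close> of \<open>V\<close>, extended by zero to \<open>T(V)\<close>.\<close>

definition Hom_T ::
  "('k::field \<Rightarrow> 'v::ab_group_add \<Rightarrow> 'v) \<Rightarrow> (bit \<Rightarrow> 'v set) \<Rightarrow> (bit \<Rightarrow> 'v set)
     \<Rightarrow> nat \<Rightarrow> nat \<Rightarrow> 'v set \<Rightarrow> 'v cochain set" where
  "Hom_T scale M W k l N =
     {\<phi>. multilinear scale \<phi> \<and> range \<phi> \<subseteq> N \<and>
         (\<forall>k' l'. (k', l') \<noteq> (k, l) \<longrightarrow> (\<forall>vs\<in>tensors M W k' l'. \<phi> vs = 0))}"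

definition C_MW ::
  "('k::field \<Rightarrow> 'v::ab_group_add \<Rightarrow> 'v) \<Rightarrow> (bit \<Rightarrow> 'v set) \<Rightarrow> (bit \<Rightarrow> 'v set)
     \<Rightarrow> nat \<Rightarrow> nat \<Rightarrow> 'v cochain set" where
  "C_MW scale M W k l = Hom_T scale M W k l (total M)"

definition C_W ::
  "('k::field \<Rightarrow> 'v::ab_group_add \<Rightarrow> 'v) \<Rightarrow> (bit \<Rightarrow> 'v set) \<Rightarrow> (bit \<Rightarrow> 'v set)
     \<Rightarrow> nat \<Rightarrow> 'v cochain set" where
  "C_W scale M W k = Hom_T scale M W 0 k (total W)"

text \<open>For an odd element of \<open>Hom(V \<otimes> V, V)\<close>, being an associative algebra structure.\<close>

definition assoc_structure ::
  "(bit \<Rightarrow> 'v::ab_group_add set) \<Rightarrow> 'v cochain \<Rightarrow> bool" where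
  "assoc_structure G d \<longleftrightarrow> has_parity G 1 d \<and> bracket G d d = 0"

abbreviation D ::
  "(bit \<Rightarrow> 'v::ab_group_add set) \<Rightarrow> (bit \<Rightarrow> 'v set) \<Rightarrow> 'v cochain \<Rightarrow> 'v cochain \<Rightarrow> 'v cochain" where
  "D M W \<alpha> \<equiv> bracket (grade M W) \<alpha>"


text \<open>The module \<open>V[t]/(t^2)\<close> is \<^typ>\<open>'v \<times> 'v\<close>, with \<open>(a, b)\<close> standing for \<open>a + t b\<close>.
  \<open>dual_ext \<phi>\<close> is the \<open>t\<close>-multilinear extension of \<open>\<phi>\<close>.\<close>

definition dual_grade :: "(bit \<Rightarrow> 'v::ab_group_add set) \<Rightarrow> bit \<Rightarrow> ('v \<times> 'v) set" where
  "dual_grade G p = G p \<times> G p"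

definition dual_ext :: "'v::ab_group_add cochain \<Rightarrow> ('v \<times> 'v) cochain" where
  "dual_ext \<phi> xs =
     (\<phi> (map fst xs), \<Sum>i<length xs. \<phi> ((map fst xs)[i := snd (xs ! i)]))"

definition mult_t :: "'v::ab_group_add \<times> 'v \<Rightarrow> 'v \<times> 'v" where
  "mult_t x = (0, fst x)"

text \<open>\<open>d = \<delta> + \<mu> + t (lam + \<psi>)\<close>.\<close>

definition inf_deform ::
  "'v::ab_group_add cochain \<Rightarrow> 'v cochain \<Rightarrow> 'v cochain \<Rightarrow> 'v cochain \<Rightarrow> ('v \<times> 'v) cochain" where
  "inf_deform \<delta> \<mu> lam \<psi> = dual_ext \<delta> + dual_ext \<mu> + (mult_t \<circ> dual_ext (lam + \<psi>))"

definition is_inf_ext ::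
  "('k::field \<Rightarrow> 'v::ab_group_add \<Rightarrow> 'v) \<Rightarrow> (bit \<Rightarrow> 'v set) \<Rightarrow> (bit \<Rightarrow> 'v set)
     \<Rightarrow> 'v cochain \<Rightarrow> 'v cochain \<Rightarrow> 'v cochain \<Rightarrow> 'v cochain \<Rightarrow> bool" where
  "is_inf_ext scale M W \<delta> \<mu> lam \<psi> \<longleftrightarrow>
     lam \<in> C_MW scale M W 1 1 \<and> has_parity (grade M W) 1 lam \<and>
     \<psi> \<in> C_MW scale M W 0 2 \<and> has_parity (grade M W) 1 \<psi> \<and>
     bracket (dual_grade (grade M W)) (inf_deform \<delta> \<mu> lam \<psi>) (inf_deform \<delta> \<mu> lam \<psi>) = 0"

definition inf_exts ::
  "('k::field \<Rightarrow> 'v::ab_group_add \<Rightarrow> 'v) \<Rightarrow> (bit \<Rightarrow> 'v set) \<Rightarrow> (bit \<Rightarrow> 'v set)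
     \<Rightarrow> 'v cochain \<Rightarrow> 'v cochain \<Rightarrow> ('v \<times> 'v) cochain set" where
  "inf_exts scale M W \<delta> \<mu> = {inf_deform \<delta> \<mu> lam \<psi> | lam \<psi>. is_inf_ext scale M W \<delta> \<mu> lam \<psi>}"

text \<open>\<open>exp(t \<beta>) = id + t \<beta>\<close> because \<open>t^2 = 0\<close>.\<close>

definition exp_t :: "'v::ab_group_add cochain \<Rightarrow> 'v \<times> 'v \<Rightarrow> 'v \<times> 'v" where
  "exp_t \<beta> x = x + mult_t (dual_ext \<beta> [x])"

text \<open>\<open>f^*(d) = f^{-1} \<circ> d \<circ> (f \<otimes> f)\<close>, with \<open>f\<close> applied to every argument.\<close>

definition pullback :: "('u \<Rightarrow> 'u) \<Rightarrow> 'u cochain \<Rightarrow> 'u cochain" where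
  "pullback f d xs = inv f (d (map f xs))"

definition inf_equiv ::
  "('k::field \<Rightarrow> 'v::ab_group_add \<Rightarrow> 'v) \<Rightarrow> (bit \<Rightarrow> 'v set) \<Rightarrow> (bit \<Rightarrow> 'v set)
     \<Rightarrow> 'v cochain \<Rightarrow> 'v cochain \<Rightarrow> (('v \<times> 'v) cochain \<times> ('v \<times> 'v) cochain) set" where
  "inf_equiv scale M W \<delta> \<mu> =
     {(d, d'). d \<in> inf_exts scale M W \<delta> \<mu> \<and> d' \<in> inf_exts scale M W \<delta> \<mu> \<and>
        (\<exists>\<beta>\<in>C_MW scale M W 0 1. has_parity (grade M W) 0 \<beta> \<and> d' = pullback (exp_t \<beta>) d)}"


text \<open>Elements of a quotient \<open>A / B\<close> are the cosets \<open>a +o B\<close>; its zero is \<open>0 +o B\<close>.  This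
  also covers quotients of quotients, cosets being added elementwise.\<close>

definition quot :: "'a::plus set \<Rightarrow> 'a set \<Rightarrow> 'a set set" where
  "quot A B = (\<lambda>a. a +o B) ` A"

definition Z_mu ::
  "('k::field \<Rightarrow> 'v::ab_group_add \<Rightarrow> 'v) \<Rightarrow> (bit \<Rightarrow> 'v set) \<Rightarrow> (bit \<Rightarrow> 'v set) \<Rightarrow> 'v cochain
     \<Rightarrow> nat \<Rightarrow> nat \<Rightarrow> 'v cochain set" where
  "Z_mu scale M W \<mu> k l = {\<phi> \<in> C_MW scale M W k l. D M W \<mu> \<phi> = 0}"

definition B_mu ::
  "('k::field \<Rightarrow> 'v::ab_group_add \<Rightarrow> 'v) \<Rightarrow> (bit \<Rightarrow> 'v set) \<Rightarrow> (bit \<Rightarrow> 'v set) \<Rightarrow> 'v cochain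
     \<Rightarrow> nat \<Rightarrow> nat \<Rightarrow> 'v cochain set" where
  "B_mu scale M W \<mu> k l = (if k = 0 then {0} else D M W \<mu> ` C_MW scale M W (k - 1) l)"

definition H_mu ::
  "('k::field \<Rightarrow> 'v::ab_group_add \<Rightarrow> 'v) \<Rightarrow> (bit \<Rightarrow> 'v set) \<Rightarrow> (bit \<Rightarrow> 'v set) \<Rightarrow> 'v cochain
     \<Rightarrow> nat \<Rightarrow> nat \<Rightarrow> 'v cochain set set" where
  "H_mu scale M W \<mu> k l = quot (Z_mu scale M W \<mu> k l) (B_mu scale M W \<mu> k l)"

definition H_mu_class ::
  "('k::field \<Rightarrow> 'v::ab_group_add \<Rightarrow> 'v) \<Rightarrow> (bit \<Rightarrow> 'v set) \<Rightarrow> (bit \<Rightarrow> 'v set) \<Rightarrow> 'v cochain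
     \<Rightarrow> nat \<Rightarrow> nat \<Rightarrow> 'v cochain \<Rightarrow> 'v cochain set" where
  "H_mu_class scale M W \<mu> k l \<phi> = \<phi> +o B_mu scale M W \<mu> k l"

definition odd_Z_mu ::
  "('k::field \<Rightarrow> 'v::ab_group_add \<Rightarrow> 'v) \<Rightarrow> (bit \<Rightarrow> 'v set) \<Rightarrow> (bit \<Rightarrow> 'v set) \<Rightarrow> 'v cochain
     \<Rightarrow> nat \<Rightarrow> nat \<Rightarrow> 'v cochain set" where
  "odd_Z_mu scale M W \<mu> k l = {\<phi> \<in> Z_mu scale M W \<mu> k l. has_parity (grade M W) 1 \<phi>}"

text \<open>Numerator and denominator of \<open>H_\<mu>^{1,2}(ker D_\<delta>)\<close>, and the class map.\<close>

definition Z12_ker ::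
  "('k::field \<Rightarrow> 'v::ab_group_add \<Rightarrow> 'v) \<Rightarrow> (bit \<Rightarrow> 'v set) \<Rightarrow> (bit \<Rightarrow> 'v set)
     \<Rightarrow> 'v cochain \<Rightarrow> 'v cochain \<Rightarrow> 'v cochain set" where
  "Z12_ker scale M W \<delta> \<mu> = {\<phi> \<in> C_MW scale M W 1 2. D M W \<mu> \<phi> = 0 \<and> D M W \<delta> \<phi> = 0}"

definition B12_ker ::
  "('k::field \<Rightarrow> 'v::ab_group_add \<Rightarrow> 'v) \<Rightarrow> (bit \<Rightarrow> 'v set) \<Rightarrow> (bit \<Rightarrow> 'v set)
     \<Rightarrow> 'v cochain \<Rightarrow> 'v cochain \<Rightarrow> 'v cochain set" where
  "B12_ker scale M W \<delta> \<mu> = D M W \<mu> ` {\<psi> \<in> C_MW scale M W 0 2. D M W \<delta> \<psi> = 0}"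

definition H12_ker_class ::
  "('k::field \<Rightarrow> 'v::ab_group_add \<Rightarrow> 'v) \<Rightarrow> (bit \<Rightarrow> 'v set) \<Rightarrow> (bit \<Rightarrow> 'v set)
     \<Rightarrow> 'v cochain \<Rightarrow> 'v cochain \<Rightarrow> 'v cochain \<Rightarrow> 'v cochain set" where
  "H12_ker_class scale M W \<delta> \<mu> \<phi> = \<phi> +o B12_ker scale M W \<delta> \<mu>"

text \<open>\<open>D_bar ... k l\<close> maps \<open>H_\<mu>^{k,l}\<close> to \<open>H_\<mu>^{k,l+1}\<close>.  The union ranges over the
  representatives of the class; all its members coincide.\<close>

definition D_bar ::
  "('k::field \<Rightarrow> 'v::ab_group_add \<Rightarrow> 'v) \<Rightarrow> (bit \<Rightarrow> 'v set) \<Rightarrow> (bit \<Rightarrow> 'v set)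
     \<Rightarrow> 'v cochain \<Rightarrow> 'v cochain \<Rightarrow> nat \<Rightarrow> nat \<Rightarrow> 'v cochain set \<Rightarrow> 'v cochain set" where
  "D_bar scale M W \<delta> \<mu> k l X = (\<Union>\<phi>\<in>X. H_mu_class scale M W \<mu> k (l + 1) (D M W \<delta> \<phi>))"

definition Z02_bar ::
  "('k::field \<Rightarrow> 'v::ab_group_add \<Rightarrow> 'v) \<Rightarrow> (bit \<Rightarrow> 'v set) \<Rightarrow> (bit \<Rightarrow> 'v set)
     \<Rightarrow> 'v cochain \<Rightarrow> 'v cochain \<Rightarrow> 'v cochain set set" where
  "Z02_bar scale M W \<delta> \<mu> =
     {X \<in> H_mu scale M W \<mu> 0 2. D_bar scale M W \<delta> \<mu> 0 2 X = H_mu_class scale M W \<mu> 0 3 0}"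

definition B02_bar ::
  "('k::field \<Rightarrow> 'v::ab_group_add \<Rightarrow> 'v) \<Rightarrow> (bit \<Rightarrow> 'v set) \<Rightarrow> (bit \<Rightarrow> 'v set)
     \<Rightarrow> 'v cochain \<Rightarrow> 'v cochain \<Rightarrow> 'v cochain set set" where
  "B02_bar scale M W \<delta> \<mu> = D_bar scale M W \<delta> \<mu> 0 1 ` H_mu scale M W \<mu> 0 1"

text \<open>The odd cochains \<open>\<tau>\<close> having a class \<open>[\<tau>]\<close> in \<open>H_{\<mu>,\<delta>}^{0,2}\<close>, this class, and the set of all
  these classes, i.e. the odd part of \<^term>\<open>quot (Z02_bar scale M W \<delta> \<mu>) (B02_bar scale M W \<delta> \<mu>)\<close>.\<close>

definition odd_reps02 ::
  "('k::field \<Rightarrow> 'v::ab_group_add \<Rightarrow> 'v) \<Rightarrow> (bit \<Rightarrow> 'v set) \<Rightarrow> (bit \<Rightarrow> 'v set)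
     \<Rightarrow> 'v cochain \<Rightarrow> 'v cochain \<Rightarrow> 'v cochain set" where
  "odd_reps02 scale M W \<delta> \<mu> =
     {\<tau> \<in> odd_Z_mu scale M W \<mu> 0 2. H_mu_class scale M W \<mu> 0 2 \<tau> \<in> Z02_bar scale M W \<delta> \<mu>}"

definition H02_class ::
  "('k::field \<Rightarrow> 'v::ab_group_add \<Rightarrow> 'v) \<Rightarrow> (bit \<Rightarrow> 'v set) \<Rightarrow> (bit \<Rightarrow> 'v set)
     \<Rightarrow> 'v cochain \<Rightarrow> 'v cochain \<Rightarrow> 'v cochain \<Rightarrow> 'v cochain set set" where
  "H02_class scale M W \<delta> \<mu> \<tau> = H_mu_class scale M W \<mu> 0 2 \<tau> +o B02_bar scale M W \<delta> \<mu>"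

definition odd_H02 ::
  "('k::field \<Rightarrow> 'v::ab_group_add \<Rightarrow> 'v) \<Rightarrow> (bit \<Rightarrow> 'v set) \<Rightarrow> (bit \<Rightarrow> 'v set)
     \<Rightarrow> 'v cochain \<Rightarrow> 'v cochain \<Rightarrow> 'v cochain set set set" where
  "odd_H02 scale M W \<delta> \<mu> = H02_class scale M W \<delta> \<mu> ` odd_reps02 scale M W \<delta> \<mu>"

end

theory Submission
  imports Defs
begin

text \<open>A bracket of cochains over \<open>V[t]/(t\<^sup>2)\<close> splits by powers of \<open>t\<close>, so that
  \<open>\<delta> + \<mu> + t (\<lambda> + \<psi>)\<close> squares to zero iff \<open>[\<delta> + \<mu>, \<lambda> + \<psi>] = 0\<close>, and splitting this further by the
  numbers of \<open>M\<close>- and \<open>W\<close>-inputs gives the three equations \<open>[\<mu>, \<lambda>] = 0\<close>,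
  \<open>[\<delta>, \<lambda>] + [\<mu>, \<psi>] = 0\<close>, \<open>[\<delta>, \<psi>] = 0\<close>.  Pulling back along \<open>exp(t \<beta>)\<close> adds \<open>[\<mu>, \<beta>]\<close> to \<open>\<lambda>\<close> and
  \<open>[\<delta>, \<beta>]\<close> to \<open>\<psi>\<close>.  Since \<open>D\<^sub>\<delta>\<close> and \<open>D\<^sub>\<mu>\<close> square to zero and anticommute, the classification becomes
  bookkeeping with cosets.  Two points need care: cohomology classes are taken modulo coboundaries of
  cochains of arbitrary parity, from which the part of the right parity has to be extracted; and for
  \<open>k = 0\<close> the coboundaries of \<open>D\<^sub>\<mu>\<close> vanish, so \<open>H\<^sub>\<mu>\<close>-classes are single cochains.\<close>

section \<open>Multi-additive cochains\<close>

text \<open>The pairs standing for V[t]/(t^2) come without a scalar multiplication, so the sign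
  calculus is developed for cochains that are merely additive in each argument and for an abstract
  grading; it then serves over V and over the dual numbers alike. Scalars matter only where
  membership in \<open>Hom_T\<close> has to be shown. Characteristic different from 2 enters as
  absence of 2-torsion: it makes the homogeneous parts eigenspaces of the parity involution, and it
  lets [\<alpha>, \<alpha>] = 0 be read as associativity. In place of the graded Jacobi identity,
  [\<alpha>, [\<alpha>, \<beta>]] = 0 is checked directly for even unary and odd binary \<beta>, by
  expanding all terms with associativity as a rewrite rule. Applied to \<delta>, \<mu> and \<delta>
  + \<mu>, this also yields anticommutation.\<close>

definition multi_additive :: "('v::ab_group_add) cochain \<Rightarrow> bool" where
  "multi_additive \<phi> \<longleftrightarrow>
     (\<forall>us x y ws. \<phi> (us @ (x + y) # ws) = \<phi> (us @ x # ws) + \<phi> (us @ y # ws))"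

definition of_arity :: "nat \<Rightarrow> ('v::ab_group_add) cochain \<Rightarrow> bool" where
  "of_arity n \<phi> \<longleftrightarrow> (\<forall>vs. length vs \<noteq> n \<longrightarrow> \<phi> vs = 0)"

lemma bit_neq_iff: "p \<noteq> q \<longleftrightarrow> p = q + 1" for p q :: bit
  by (cases p; cases q; simp)

lemma UNIV_bit: "(UNIV :: bit set) = {0, 1}"
  using bit.exhaust by auto

lemma sign_simps [simp]: "sign 0 v = v" "sign 1 v = - v"
  by (simp_all add: sign_def)

lemma sign_zero [simp]: "sign p 0 = (0 :: 'v::ab_group_add)"
  by (simp add: sign_def)

lemma sign_add: "sign p (x + y) = sign p x + sign p (y :: 'v::ab_group_add)"
  by (simp add: sign_def)

lemma sign_sum: "sign p (\<Sum>i\<in>I. f i) = (\<Sum>i\<in>I. sign p (f i) :: 'v::ab_group_add)"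
  by (simp add: sign_def sum_negf)

lemma sign_sign: "sign p (sign q v) = sign (p + q) (v :: 'v::ab_group_add)"
  by (cases p; cases q) (simp_all add: sign_def)

text \<open>Instantiated with a slot of a cochain, with \<open>component\<close>, with
  \<open>koszul\<close> and with the bracket, so that the consequences of additivity are derived
  once.\<close>

lemma additiveD:
  fixes f :: "'a::ab_group_add \<Rightarrow> 'b::ab_group_add"
  assumes "\<And>x y. f (x + y) = f x + f y"
  shows "f 0 = 0" "f (- x) = - f x" "f (x - y) = f x - f y"
proof -
  show 0: "f 0 = 0"
    using assms[of 0 0] by simp
  show 1: "f (- x) = - f x" for x
    using assms[of x "- x"] 0 by (simp add: eq_neg_iff_add_eq_0 add.commute)
  show "f (x - y) = f x - f y"
    using assms[of x "- y"] 1 by simp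
qed

lemma multi_additive_add:
  "multi_additive \<phi> \<Longrightarrow> \<phi> (us @ (x + y) # ws) = \<phi> (us @ x # ws) + \<phi> (us @ y # ws)"
  by (simp add: multi_additive_def)

lemma multi_additive_simps:
  assumes "multi_additive \<phi>"
  shows "\<phi> (us @ 0 # ws) = 0" "\<phi> (us @ (- x) # ws) = - \<phi> (us @ x # ws)"
    "\<phi> (us @ (x - y) # ws) = \<phi> (us @ x # ws) - \<phi> (us @ y # ws)"
    "\<phi> (us @ sign p x # ws) = sign p (\<phi> (us @ x # ws))"
  using additiveD[of "\<lambda>v. \<phi> (us @ v # ws)", OF multi_additive_add[OF assms]]
  by (auto simp: sign_def)

lemma multi_additive_list0: "multi_additive \<phi> \<Longrightarrow> 0 \<in> set vs \<Longrightarrow> \<phi> vs = 0"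
  by (metis multi_additive_simps(1) split_list)

lemma multi_additive_plus: "multi_additive \<phi> \<Longrightarrow> multi_additive \<chi> \<Longrightarrow> multi_additive (\<phi> + \<chi>)"
  by (simp add: multi_additive_def algebra_simps)

lemma multi_additive_zero: "multi_additive 0"
  by (simp add: multi_additive_def)

lemma multi_additive_Cons: "multi_additive \<phi> \<Longrightarrow> multi_additive (\<lambda>vs. \<phi> (v # vs))"
  unfolding multi_additive_def by (metis append_Cons)

lemma multi_additive_arg1:
  assumes "multi_additive \<phi>"
  shows "\<phi> ((x + y) # ws) = \<phi> (x # ws) + \<phi> (y # ws)"
    "\<phi> ((- x) # ws) = - \<phi> (x # ws)" "\<phi> ((x - y) # ws) = \<phi> (x # ws) - \<phi> (y # ws)"
    "\<phi> (0 # ws) = 0"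
  using multi_additive_add[OF assms, of "[]"] multi_additive_simps[OF assms, of "[]"] by auto

lemma multi_additive_arg2:
  assumes "multi_additive \<phi>"
  shows "\<phi> (u # (x + y) # ws) = \<phi> (u # x # ws) + \<phi> (u # y # ws)"
    "\<phi> (u # (- x) # ws) = - \<phi> (u # x # ws)" "\<phi> (u # (x - y) # ws) = \<phi> (u # x # ws) - \<phi> (u # y # ws)"
    "\<phi> (u # 0 # ws) = 0"
  using multi_additive_add[OF assms, of "[u]"] multi_additive_simps[OF assms, of "[u]"] by auto

lemma multi_additive_arg3:
  assumes "multi_additive \<phi>"
  shows "\<phi> (u # v # (x + y) # ws) = \<phi> (u # v # x # ws) + \<phi> (u # v # y # ws)"
    "\<phi> (u # v # (- x) # ws) = - \<phi> (u # v # x # ws)"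
    "\<phi> (u # v # (x - y) # ws) = \<phi> (u # v # x # ws) - \<phi> (u # v # y # ws)"
    "\<phi> (u # v # 0 # ws) = 0"
  using multi_additive_add[OF assms, of "[u, v]"] multi_additive_simps[OF assms, of "[u, v]"] by auto

lemmas multi_additive_args = multi_additive_arg1 multi_additive_arg2 multi_additive_arg3

text \<open>Expanding every argument as \<open>f x + g x\<close> gives a sum over all choices of
  summands. It serves for the splitting by parity and for the splitting into M and W. The induction
  fixes the first argument, which leaves a multi-additive cochain of the others.\<close>

lemma multi_additive_eq_zero:
  assumes "multi_additive \<phi>" and "\<And>x. x = f x + g x"
    and "\<And>ys. list_all2 (\<lambda>x y. y = f x \<or> y = g x) xs ys \<Longrightarrow> \<phi> ys = 0"
  shows "\<phi> xs = 0"
  using assms(1,3)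
proof (induction xs arbitrary: \<phi>)
  case Nil
  then show ?case by simp
next
  case (Cons x xs)
  have "\<phi> (y # xs) = 0" if "y = f x \<or> y = g x" for y
    by (rule Cons.IH[OF multi_additive_Cons[OF Cons.prems(1)]])
       (use Cons.prems(2) that in simp)
  then have "\<phi> (f x # xs) = 0" "\<phi> (g x # xs) = 0" by auto
  then show ?case
    using multi_additive_arg1(1)[OF Cons.prems(1), of "f x" "g x" xs] assms(2)[of x] by simp
qed

lemma multi_additive_map_sign:
  assumes "multi_additive \<phi>" "length ps = length vs"
  shows "\<phi> (map2 sign ps vs) = sign (sum_list ps) (\<phi> vs)"
  using assms(2,1)
proof (induction ps vs arbitrary: \<phi> rule: list_induct2)
  case Nil
  then show ?case by simp
next
  case (Cons p ps v vs)
  have "\<phi> (sign p v # map2 sign ps vs) = sign p (\<phi> (v # map2 sign ps vs))"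
    using multi_additive_simps(4)[OF Cons.prems, of "[]"] by simp
  also have "\<dots> = sign p (sign (sum_list ps) (\<phi> (v # vs)))"
    using Cons.IH[OF multi_additive_Cons[OF Cons.prems]] by simp
  finally show ?case by (simp add: sign_sign)
qed

section \<open>Composition products of cochains, by arity\<close>

lemma circ_zero_right:
  "multi_additive \<phi> \<Longrightarrow> circ G q \<phi> 0 = 0"
  by (rule ext) (simp add: circ_def multi_additive_simps)

lemma circ_zero_left: "circ G q 0 \<chi> = 0"
  by (rule ext) (simp add: circ_def)

lemma circ_add_right:
  "multi_additive \<phi> \<Longrightarrow> circ G q \<phi> (\<chi> + \<chi>') = circ G q \<phi> \<chi> + circ G q \<phi> \<chi>'"
  by (rule ext) (simp add: circ_def multi_additive_add sum.distrib)

lemma circ_add_left: "circ G q (\<phi> + \<phi>') \<chi> = circ G q \<phi> \<chi> + circ G q \<phi>' \<chi>"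
  by (rule ext) (simp add: circ_def sum.distrib)

lemma circ_eq_zero:
  assumes "\<And>us vs ws. \<phi> (us @ \<chi> vs # ws) = 0"
  shows "circ G q \<phi> \<chi> = 0"
  by (rule ext) (simp add: circ_def assms)

text \<open>Of the inner sum over arities only one term survives; the conditional discards the
  positions where fewer than \<open>l\<close> arguments are left.\<close>

lemma circ_of_arity:
  assumes "multi_additive \<phi>" "of_arity l \<chi>"
  shows "circ G q \<phi> \<chi> vs = (\<Sum>i\<in>{0..length vs}. if i + l \<le> length vs
     then \<phi> (map (koszul G q) (take i vs) @ \<chi> (take l (drop i vs)) # drop (i + l) vs) else 0)"
  unfolding circ_def
proof (intro sum.cong refl)
  fix i assume "i \<in> {0..length vs}"
  have *: "\<phi> (map (koszul G q) (take i vs) @ [\<chi> (take l' (drop i vs))] @ drop (i + l') vs) = 0"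
    if "l' \<noteq> l" "l' \<in> {0..length vs - i}" for l'
  proof -
    \<comment> \<open>The value 0 of \<chi> still fills a slot of \<phi>, and additivity in that
      slot kills the term.\<close>
    from that have "\<chi> (take l' (drop i vs)) = 0"
      using assms(2) by (auto simp: of_arity_def)
    then show ?thesis
      using multi_additive_simps(1)[OF assms(1)] by simp
  qed
  show "(\<Sum>l'\<in>{0..length vs - i}. \<phi> (map (koszul G q) (take i vs) @ [\<chi> (take l' (drop i vs))] @ drop (i + l') vs))
    = (if i + l \<le> length vs
     then \<phi> (map (koszul G q) (take i vs) @ \<chi> (take l (drop i vs)) # drop (i + l) vs) else 0)"
  proof (cases "i + l \<le> length vs")
    case True
    then have "l \<in> {0..length vs - i}" by auto
    then show ?thesis
      using * True by (subst sum.remove[of _ l]) (auto intro!: sum.neutral)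
  next
    case False
    then have "l' \<noteq> l" if "l' \<in> {0..length vs - i}" for l'
      using that \<open>i \<in> {0..length vs}\<close> by auto
    then show ?thesis
      using * False by (auto intro!: sum.neutral)
  qed
qed

text \<open>\<chi> consumes \<open>l\<close> arguments and hands one back to \<phi>; the count is
  stated with \<open>n + 1\<close> to avoid subtraction.\<close>

lemma of_arity_circ:
  assumes "multi_additive \<phi>" "of_arity k \<phi>" "of_arity l \<chi>" "n + 1 = k + l"
  shows "of_arity n (circ G q \<phi> \<chi>)"
  unfolding of_arity_def circ_of_arity[OF assms(1,3)]
proof (intro allI impI sum.neutral ballI)
  fix vs :: "'a list" and i
  assume "length vs \<noteq> n"
  then have "length (map (koszul G q) (take i vs) @ \<chi> (take l (drop i vs)) # drop (i + l) vs) \<noteq> k"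
    if "i + l \<le> length vs"
    using assms(4) that by simp
  then show "(if i + l \<le> length vs then
      \<phi> (map (koszul G q) (take i vs) @ \<chi> (take l (drop i vs)) # drop (i + l) vs) else 0) = 0"
    using assms(2) unfolding of_arity_def by auto
qed

text \<open>The low-arity products, named after the arities of \<phi> and \<chi>. The arguments
  passed over by \<chi> carry the Koszul sign.\<close>

lemma circ_1_2:
  assumes "multi_additive \<phi>" "of_arity 2 \<chi>"
  shows "circ G q \<phi> \<chi> [x, y] = \<phi> [\<chi> [x, y]]"
  by (simp add: circ_of_arity[OF assms] eval_nat_numeral)

lemma circ_2_1:
  assumes "multi_additive \<phi>" "of_arity 2 \<phi>" "of_arity 1 \<chi>"
  shows "circ G q \<phi> \<chi> [x, y] = \<phi> [\<chi> [x], y] + \<phi> [koszul G q x, \<chi> [y]]"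
  by (simp add: circ_of_arity[OF assms(1,3)] eval_nat_numeral)

lemma circ_2_2:
  assumes "multi_additive \<phi>" "of_arity 2 \<chi>"
  shows "circ G q \<phi> \<chi> [x, y, z] = \<phi> [\<chi> [x, y], z] + \<phi> [koszul G q x, \<chi> [y, z]]"
  by (simp add: circ_of_arity[OF assms] eval_nat_numeral)

lemma circ_3_2:
  assumes "multi_additive \<phi>" "of_arity 2 \<chi>"
  shows "circ G q \<phi> \<chi> [x, y, z, w] = \<phi> [\<chi> [x, y], z, w] + \<phi> [koszul G q x, \<chi> [y, z], w]
    + \<phi> [koszul G q x, koszul G q y, \<chi> [z, w]]"
  by (simp add: circ_of_arity[OF assms] eval_nat_numeral)

lemma circ_2_3:
  assumes "multi_additive \<phi>" "of_arity 3 \<chi>"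
  shows "circ G q \<phi> \<chi> [x, y, z, w] = \<phi> [\<chi> [x, y, z], w] + \<phi> [koszul G q x, \<chi> [y, z, w]]"
  by (simp add: circ_of_arity[OF assms] eval_nat_numeral)

lemma of_arity_eqI:
  assumes "of_arity n \<phi>" "of_arity n \<chi>" "\<And>vs. length vs = n \<Longrightarrow> \<phi> vs = \<chi> vs"
  shows "\<phi> = \<chi>"
  using assms unfolding of_arity_def by (intro ext) metis

lemma length_eq_4: "length vs = 4 \<longleftrightarrow> (\<exists>x y z w. vs = [x, y, z, w])"
  by (auto simp: eval_nat_numeral length_Suc_conv)

lemma length_eq_3: "length vs = 3 \<longleftrightarrow> (\<exists>x y z. vs = [x, y, z])"
  by (auto simp: eval_nat_numeral length_Suc_conv)

lemma length_eq_2: "length vs = 2 \<longleftrightarrow> (\<exists>x y. vs = [x, y])"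
  by (auto simp: eval_nat_numeral length_Suc_conv)

lemma of_arity_plus: "of_arity n \<phi> \<Longrightarrow> of_arity n \<chi> \<Longrightarrow> of_arity n (\<phi> + \<chi>)"
  by (simp add: of_arity_def)

lemma of_arity_zero: "of_arity n 0"
  by (simp add: of_arity_def)

section \<open>Parity gradings\<close>

text \<open>What the sign calculus uses of a Z_2-grading, the last condition being what remains of
  characteristic different from 2. It is instantiated at \<open>grade M W\<close> and at
  \<open>dual_grade\<close>.\<close>

locale parity_grading =
  fixes G :: "bit \<Rightarrow> 'v::ab_group_add set"
  assumes zero_mem: "0 \<in> G p"
    and diff_mem: "x \<in> G p \<Longrightarrow> y \<in> G p \<Longrightarrow> x - y \<in> G p"
    and decomp: "\<exists>a\<in>G 0. \<exists>b\<in>G 1. v = a + b"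
    and indep: "x \<in> G 0 \<Longrightarrow> x \<in> G 1 \<Longrightarrow> x = 0"
    and no_2_torsion: "v + v = 0 \<Longrightarrow> v = (0::'v)"
begin

lemma minus_mem: "x \<in> G p \<Longrightarrow> - x \<in> G p"
  using diff_mem[OF zero_mem] by simp

lemma add_mem: "x \<in> G p \<Longrightarrow> y \<in> G p \<Longrightarrow> x + y \<in> G p"
  using diff_mem[OF _ minus_mem] by simp

lemma sum_mem: "(\<And>i. i \<in> I \<Longrightarrow> f i \<in> G p) \<Longrightarrow> sum f I \<in> G p"
  by (induction I rule: infinite_finite_induct) (auto simp: zero_mem add_mem)

lemma sign_mem: "x \<in> G p \<Longrightarrow> sign q x \<in> G p"
  by (simp add: sign_def minus_mem)

lemma indep': "x \<in> G p \<Longrightarrow> x \<in> G (p + 1) \<Longrightarrow> x = 0"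
  using indep by (cases p) auto

lemma decomp': "\<exists>a\<in>G p. \<exists>b\<in>G (p + 1). v = a + b"
proof -
  obtain a b where ab: "a \<in> G 0" "b \<in> G 1" "v = a + b"
    using decomp[of v] by auto
  then have "v = b + a" by (simp add: add.commute)
  with ab have "(\<exists>a\<in>G 0. \<exists>b\<in>G 1. v = a + b) \<and> (\<exists>a\<in>G 1. \<exists>b\<in>G 0. v = a + b)"
    by blast
  then show ?thesis by (cases p) simp_all
qed

lemma component_eq:
  assumes "a \<in> G p" "b \<in> G (p + 1)"
  shows "component G p (a + b) = a"
  unfolding component_def
proof (rule the_equality)
  show "a \<in> G p \<and> (\<exists>b'\<in>G (p + 1). a + b = a + b')"
    using assms by auto
  fix a' assume "a' \<in> G p \<and> (\<exists>b'\<in>G (p + 1). a + b = a' + b')"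
  then obtain b' where b': "a' \<in> G p" "b' \<in> G (p + 1)" "a + b = a' + b'" by auto
  then have "a' - a = b - b'" by (simp add: algebra_simps)
  then have "a' - a = 0"
    using diff_mem[OF b'(1) assms(1)] diff_mem[OF assms(2) b'(2)] by (intro indep'[of _ p]) simp_all
  then show "a' = a" by simp
qed

lemma component_same: "v \<in> G p \<Longrightarrow> component G p v = v"
  using component_eq[of v p 0] zero_mem by simp

lemma component_other: "v \<in> G q \<Longrightarrow> q \<noteq> p \<Longrightarrow> component G p v = 0"
  using component_eq[of 0 p v] zero_mem by (simp add: bit_neq_iff)

lemma component_mem: "component G p v \<in> G p"
  using decomp'[of p v] component_eq by auto

lemma component_sum: "v = component G 0 v + component G 1 v"
proof -
  obtain a b where *: "a \<in> G 0" "b \<in> G 1" "v = a + b" using decomp by blast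
  then have "component G 0 v = a" "component G 1 v = b"
    using component_eq[of a 0 b] component_eq[of b 1 a] by (simp_all add: add.commute)
  then show ?thesis using * by simp
qed

lemma component_add: "component G p (v + w) = component G p v + component G p w"
proof -
  obtain a b where *: "a \<in> G p" "b \<in> G (p + 1)" "v = a + b" using decomp' by blast
  obtain c e where **: "c \<in> G p" "e \<in> G (p + 1)" "w = c + e" using decomp' by blast
  have "v + w = (a + c) + (b + e)" using * ** by simp
  then have "component G p (v + w) = a + c"
    using component_eq[OF add_mem add_mem] * ** by metis
  then show ?thesis using component_eq * ** by simp
qed

lemmas component_simps = additiveD[of "component G p" for p, OF component_add]

lemma component_sum': "component G q v + component G (q + 1) v = v"
  using component_sum[of v] by (cases q) (simp_all add: add.commute)

section \<open>The parity involution and the parity of cochains\<close>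

abbreviation s :: "'v \<Rightarrow> 'v" where "s \<equiv> koszul G 1"

lemma koszul_0 [simp]: "koszul G 0 = id"
  using component_sum by (auto simp: koszul_def fun_eq_iff)

lemma koszul_1: "s v = component G 0 v - component G 1 v"
  by (simp add: koszul_def)

lemma koszul_1_eq: "s v = sign p (component G p v) - sign p (component G (p + 1) v)"
  by (cases p) (simp_all add: koszul_1)

lemma koszul_add: "koszul G q (v + w) = koszul G q v + koszul G q w"
  by (simp add: koszul_def component_add sign_add algebra_simps)

lemmas koszul_additive = additiveD[of "koszul G q" for q, OF koszul_add]

lemma koszul_sum: "koszul G q (\<Sum>i\<in>I. f i) = (\<Sum>i\<in>I. koszul G q (f i))"
  by (induction I rule: infinite_finite_induct) (auto simp: koszul_add koszul_additive)

lemma s_s [simp]: "s (s v) = v"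
proof -
  have "s (s v) = component G 0 v + component G 1 v"
    by (simp add: koszul_1 component_simps component_same[OF component_mem]
        component_other[OF component_mem])
  then show ?thesis using component_sum by simp
qed

lemma s_koszul: "s (koszul G q v) = koszul G q (s v)"
  by (cases q) simp_all

text \<open>The homogeneous parts are the eigenspaces of \<open>s\<close> for the eigenvalues 1 and
  -1; that eigenvectors are homogeneous rests on the absence of 2-torsion.\<close>

lemma s_mem_iff: "v \<in> G p \<longleftrightarrow> s v = sign p v"
proof
  assume "v \<in> G p"
  then show "s v = sign p v"
    by (cases p) (simp_all add: koszul_1 component_same component_other)
next
  assume *: "s v = sign p v"
  have "sign p (component G p v) - sign p (component G (p + 1) v)
    = sign p (component G p v) + sign p (component G (p + 1) v)"
    using * unfolding koszul_1_eq[of v p] sign_add[symmetric] component_sum' .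
  \<comment> \<open>The component of the wrong parity equals its own negative.\<close>
  then have "- sign p (component G (p + 1) v) = sign p (component G (p + 1) v)"
    by (metis add_left_cancel diff_conv_add_uminus)
  then have "sign p (component G (p + 1) v) = 0"
    by (metis eq_neg_iff_add_eq_0 no_2_torsion)
  then have "component G (p + 1) v = 0"
    by (cases p) simp_all
  then show "v \<in> G p"
    using component_sum'[of p v] component_mem[of p v] by simp
qed

lemma map_s_homogeneous: "list_all2 (\<lambda>p v. v \<in> G p) ps vs \<Longrightarrow> map s vs = map2 sign ps vs"
  by (induction rule: list_all2_induct) (auto simp: s_mem_iff)

text \<open>Expressing parity as equivariance under \<open>s\<close> absorbs all Koszul signs into applications of \<open>s\<close>, so
  that identities of cochains can be checked on arbitrary instead of homogeneous arguments.\<close>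

lemma has_parity_iff:
  assumes "multi_additive \<phi>"
  shows "has_parity G q \<phi> \<longleftrightarrow> (\<forall>vs. s (\<phi> vs) = sign q (\<phi> (map s vs)))"
proof
  assume *: "\<forall>vs. s (\<phi> vs) = sign q (\<phi> (map s vs))"
  show "has_parity G q \<phi>"
    unfolding has_parity_def
  proof (intro allI impI)
    fix ps vs assume ps: "list_all2 (\<lambda>p v. v \<in> G p) ps vs"
    then have "s (\<phi> vs) = sign (q + sum_list ps) (\<phi> vs)"
      using * map_s_homogeneous[OF ps] multi_additive_map_sign[OF assms list_all2_lengthD[OF ps]]
      by (simp add: sign_sign)
    then show "\<phi> vs \<in> G (q + sum_list ps)"
      by (simp add: s_mem_iff)
  qed
next
  assume par: "has_parity G q \<phi>"
  \<comment> \<open>\<chi> measures the failure of equivariance. Being multi-additive, it vanishes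
    once it vanishes on homogeneous arguments, where the parity hypothesis applies.\<close>
  define \<chi> where "\<chi> = (\<lambda>vs. s (\<phi> vs) - sign q (\<phi> (map s vs)))"
  have ma: "multi_additive \<chi>"
    unfolding \<chi>_def multi_additive_def
    by (simp add: koszul_add multi_additive_add[OF assms] sign_add)
  have "\<chi> vs = 0" for vs
  proof (rule multi_additive_eq_zero[OF ma component_sum])
    fix ys assume "list_all2 (\<lambda>x y. y = component G 0 x \<or> y = component G 1 x) vs ys"
    then have "\<exists>ps. list_all2 (\<lambda>p v. v \<in> G p) ps ys"
    proof (induction rule: list_all2_induct)
      case Nil
      then show ?case by (intro exI[of _ "[]"]) simp
    next
      case (Cons x xs y ys)
      then obtain ps p where "list_all2 (\<lambda>p v. v \<in> G p) ps ys" "y \<in> G p"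
        using component_mem by metis
      then show ?case by (intro exI[of _ "p # ps"]) simp
    qed
    then obtain ps where ps: "list_all2 (\<lambda>p v. v \<in> G p) ps ys" by blast
    then have "\<phi> ys \<in> G (q + sum_list ps)"
      using par by (simp add: has_parity_def)
    then show "\<chi> ys = 0"
      using map_s_homogeneous[OF ps] multi_additive_map_sign[OF assms list_all2_lengthD[OF ps]]
      by (simp add: \<chi>_def s_mem_iff sign_sign)
  qed
  then show "\<forall>vs. s (\<phi> vs) = sign q (\<phi> (map s vs))"
    by (simp add: \<chi>_def)
qed

lemma has_parityD:
  "multi_additive \<phi> \<Longrightarrow> has_parity G q \<phi> \<Longrightarrow> s (\<phi> vs) = sign q (\<phi> (map s vs))"
  using has_parity_iff by blast

lemma has_parity_plus: "has_parity G q \<phi> \<Longrightarrow> has_parity G q \<chi> \<Longrightarrow> has_parity G q (\<phi> + \<chi>)"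
  by (simp add: has_parity_def add_mem)

lemma has_parity_minus: "has_parity G q \<phi> \<Longrightarrow> has_parity G q \<chi> \<Longrightarrow> has_parity G q (\<phi> - \<chi>)"
  by (simp add: has_parity_def diff_mem)

lemma has_parity_sign: "has_parity G q \<phi> \<Longrightarrow> has_parity G q (\<lambda>vs. sign r (\<phi> vs))"
  by (simp add: has_parity_def sign_mem)

lemma has_parity_zero: "has_parity G q 0"
  by (simp add: has_parity_def zero_mem)

text \<open>The two equivariance rules differ by a sign, so twice the value is zero. This later
  discards the part of wrong parity.\<close>

lemma has_parity_unique:
  assumes "multi_additive \<phi>" "has_parity G q \<phi>" "has_parity G (q + 1) \<phi>"
  shows "\<phi> = 0"
proof
  fix vs
  have "s (\<phi> vs) = - s (\<phi> vs)"
    using has_parityD[OF assms(1,2), of vs] has_parityD[OF assms(1,3), of vs] by (cases q) auto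
  then have "s (\<phi> vs) = 0"
    by (metis eq_neg_iff_add_eq_0 no_2_torsion)
  then have "s (s (\<phi> vs)) = 0" using koszul_additive by metis
  then show "\<phi> vs = 0 vs" by simp
qed

section \<open>Parity parts and brackets of homogeneous cochains\<close>

lemma sum_component_lists:
  assumes "multi_additive \<phi>"
  shows "(\<Sum>ps\<in>{ps. length ps = length vs}. \<phi> (map2 (component G) ps vs)) = \<phi> vs"
  using assms
proof (induction vs arbitrary: \<phi>)
  case Nil
  have "{ps :: bit list. length ps = length ([] :: 'v list)} = {[]}" by auto
  then show ?case by simp
next
  case (Cons v vs)
  have *: "{ps :: bit list. length ps = length (v # vs)}
     = (\<lambda>(p, ps). p # ps) ` (UNIV \<times> {ps. length ps = length vs})"
    by (auto simp: length_Suc_conv)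
  have inj: "inj_on (\<lambda>(p, ps). p # ps) (UNIV \<times> {ps :: bit list. length ps = length vs})"
    by (auto simp: inj_on_def)
  have "(\<Sum>ps\<in>{ps. length ps = length (v # vs)}. \<phi> (map2 (component G) ps (v # vs)))
    = (\<Sum>p\<in>UNIV. \<Sum>ps\<in>{ps. length ps = length vs}. \<phi> (component G p v # map2 (component G) ps vs))"
    unfolding * sum.reindex[OF inj] by (simp add: sum.cartesian_product case_prod_unfold comp_def)
  also have "\<dots> = (\<Sum>p\<in>UNIV. \<phi> (component G p v # vs))"
    using Cons.IH[OF multi_additive_Cons[OF Cons.prems]] by simp
  also have "\<dots> = \<phi> (v # vs)"
    using multi_additive_arg1(1)[OF Cons.prems, of "component G 0 v" "component G 1 v" vs]
    by (simp add: UNIV_bit component_sum[of v, symmetric])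
  finally show ?case .
qed

lemma has_parity_components:
  assumes "has_parity G q \<phi>" "length ps = length vs"
  shows "\<phi> (map2 (component G) ps vs) \<in> G (q + sum_list ps)"
proof -
  have "list_all2 (\<lambda>p v. v \<in> G p) ps (map2 (component G) ps vs)"
    using assms(2) by (auto simp: list_all2_conv_all_nth component_mem)
  then show ?thesis using assms(1) by (simp add: has_parity_def)
qed

text \<open>Each summand already has the parity onto which it is projected, so the sum is the full
  expansion of \<phi> into homogeneous arguments.\<close>

lemma parity_part_same:
  assumes "multi_additive \<phi>" "has_parity G q \<phi>"
  shows "parity_part G q \<phi> = \<phi>"
proof
  fix vs
  have "parity_part G q \<phi> vs = (\<Sum>ps\<in>{ps. length ps = length vs}. \<phi> (map2 (component G) ps vs))"
    unfolding parity_part_def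
    by (intro sum.cong refl component_same has_parity_components assms(2)) simp
  then show "parity_part G q \<phi> vs = \<phi> vs"
    by (simp add: sum_component_lists[OF assms(1)])
qed

lemma parity_part_other:
  assumes "has_parity G q \<phi>" "q \<noteq> r"
  shows "parity_part G r \<phi> = 0"
proof
  fix vs
  show "parity_part G r \<phi> vs = 0 vs"
    unfolding parity_part_def zero_fun_apply
    by (intro sum.neutral ballI component_other[OF has_parity_components[OF assms(1)]])
       (use assms(2) in auto)
qed

lemma parity_part_sum:
  assumes "multi_additive \<phi>"
  shows "parity_part G q \<phi> + parity_part G (q + 1) \<phi> = \<phi>"
proof
  fix vs
  have "(parity_part G q \<phi> + parity_part G (q + 1) \<phi>) vs
      = (\<Sum>ps\<in>{ps. length ps = length vs}. \<phi> (map2 (component G) ps vs))"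
    unfolding parity_part_def plus_fun_apply sum.distrib[symmetric]
  proof (intro sum.cong refl)
    fix ps :: "bit list"
    have "q + 1 + sum_list ps = q + sum_list ps + 1" by (simp only: ac_simps)
    then show "component G (q + sum_list ps) (\<phi> (map2 (component G) ps vs))
      + component G (q + 1 + sum_list ps) (\<phi> (map2 (component G) ps vs))
      = \<phi> (map2 (component G) ps vs)"
      by (simp only: component_sum')
  qed
  then show "(parity_part G q \<phi> + parity_part G (q + 1) \<phi>) vs = \<phi> vs"
    by (simp add: sum_component_lists[OF assms])
qed

lemma has_parity_part:
  assumes "multi_additive \<phi>"
  shows "has_parity G q (parity_part G q \<phi>)"
  unfolding has_parity_def
proof (intro allI impI)
  fix ps vs assume ps: "list_all2 (\<lambda>p v. v \<in> G p) ps vs"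
  show "parity_part G q \<phi> vs \<in> G (q + sum_list ps)"
    unfolding parity_part_def
  proof (intro sum_mem)
    fix qs :: "bit list" assume "qs \<in> {qs. length qs = length vs}"
    then have len: "length qs = length vs" "length ps = length vs"
      using list_all2_lengthD[OF ps] by auto
    show "component G (q + sum_list qs) (\<phi> (map2 (component G) qs vs)) \<in> G (q + sum_list ps)"
    proof (cases "qs = ps")
      case True
      then show ?thesis using component_mem by simp
    next
      case False
      \<comment> \<open>A pattern \<open>qs\<close> other than the actual one asks for a component
        of the wrong parity at some position; that component is zero and kills the summand.\<close>
      then obtain i where i: "i < length vs" "qs ! i \<noteq> ps ! i"
        using len by (metis nth_equalityI)
      then have "component G (qs ! i) (vs ! i) = 0"
        using component_other list_all2_nthD2[OF ps i(1)] by metis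
      then have "0 \<in> set (map2 (component G) qs vs)"
        using i len by (force simp: in_set_conv_nth)
      then show ?thesis
        using multi_additive_list0[OF assms] component_simps(1) zero_mem by simp
    qed
  qed
qed

lemma parity_part_add: "parity_part G q (\<phi> + \<chi>) = parity_part G q \<phi> + parity_part G q \<chi>"
  by (rule ext) (simp add: parity_part_def component_add sum.distrib)

text \<open>\<open>s\<close> passes through \<phi>, commutes with \<open>koszul\<close>, and passes
  through \<chi>, collecting the signs of \<open>p\<close> and \<open>q\<close>. The sign parameter
  \<open>r\<close> is free, so both terms of a bracket are covered.\<close>

lemma s_circ:
  assumes "multi_additive \<phi>" "multi_additive \<chi>" "has_parity G p \<phi>" "has_parity G q \<chi>"
  shows "s (circ G r \<phi> \<chi> vs) = sign (p + q) (circ G r \<phi> \<chi> (map s vs))"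
  unfolding circ_def koszul_sum sign_sum length_map
proof (intro sum.cong refl)
  fix i l
  have "s (\<phi> (map (koszul G r) (take i vs) @ [\<chi> (take l (drop i vs))] @ drop (i + l) vs))
     = sign p (\<phi> (map (koszul G r) (take i (map s vs)) @ s (\<chi> (take l (drop i vs))) # drop (i + l) (map s vs)))"
    using has_parityD[OF assms(1,3)] by (simp add: take_map drop_map s_koszul comp_def)
  also have "s (\<chi> (take l (drop i vs))) = sign q (\<chi> (take l (drop i (map s vs))))"
    using has_parityD[OF assms(2,4)] by (simp add: take_map drop_map)
  finally show "s (\<phi> (map (koszul G r) (take i vs) @ [\<chi> (take l (drop i vs))] @ drop (i + l) vs)) =
    sign (p + q) (\<phi> (map (koszul G r) (take i (map s vs)) @ [\<chi> (take l (drop i (map s vs)))] @ drop (i + l) (map s vs)))"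
    by (simp add: multi_additive_simps(4)[OF assms(1)] sign_sign)
qed

text \<open>The double sum over parities collapses to the one pair in which both parity parts are
  nonzero.\<close>

lemma bracket_homogeneous:
  assumes "multi_additive \<phi>" "multi_additive \<chi>" "has_parity G p \<phi>" "has_parity G q \<chi>"
  shows "bracket G \<phi> \<chi> vs = circ G q \<phi> \<chi> vs - sign (p * q) (circ G p \<chi> \<phi> vs)"
proof -
  have *: "parity_part G r \<phi> = (if r = p then \<phi> else 0)"
      "parity_part G r \<chi> = (if r = q then \<chi> else 0)" for r
    using assms parity_part_same parity_part_other by auto
  show ?thesis
    unfolding bracket_def *
    by (cases p; cases q)
       (simp_all add: circ_zero_left circ_zero_right[OF assms(1)] circ_zero_right[OF assms(2)]
         circ_zero_right[OF multi_additive_zero])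
qed

end

lemma linear_iff_additive_scale:
  assumes "vector_space scale"
  shows "Vector_Spaces.linear scale scale f \<longleftrightarrow>
    (\<forall>x y. f (x + y) = f x + f y) \<and> (\<forall>r x. f (scale r x) = scale r (f x))"
  using assms
  by (auto simp: Vector_Spaces.linear_def module_hom_def module_hom_axioms_def vector_space_def module_def)

section \<open>Bidegrees\<close>

locale graded_pair =
  fixes scale :: "'k::field \<Rightarrow> 'v::ab_group_add \<Rightarrow> 'v" and M W :: "bit \<Rightarrow> 'v set"
  assumes graded_sum: "graded_sum scale M W" and char_neq_2: "CHAR('k) \<noteq> 2"
begin

sublocale vector_space scale
  using graded_sum by (simp add: graded_sum_def)

lemma linear_iff: "Vector_Spaces.linear scale scale f \<longleftrightarrow>
    (\<forall>x y. f (x + y) = f x + f y) \<and> (\<forall>r x. f (scale r x) = scale r (f x))"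
  by (rule linear_iff_additive_scale) unfold_locales

lemma sub_M: "subspace (M p)" and sub_W: "subspace (W p)"
  using graded_sum by (auto simp: graded_sum_def)

text \<open>The type \<open>True\<close> stands for M and \<open>False\<close> for W: statements
  about the two summands are proved together, and the types of a list of arguments form a word of
  booleans.\<close>

definition part :: "bool \<Rightarrow> 'v set" where
  "part t = total (if t then M else W)"

lemma mem_part: "x \<in> part t \<longleftrightarrow> (\<exists>a\<in>(if t then M else W) 0. \<exists>b\<in>(if t then M else W) 1. x = a + b)"
  by (auto simp: part_def total_def set_plus_def)

lemma mem_grade: "x \<in> grade M W p \<longleftrightarrow> (\<exists>a\<in>M p. \<exists>b\<in>W p. x = a + b)"
  by (auto simp: grade_def set_plus_def)

lemma four_decomp: "\<exists>a\<in>M 0. \<exists>b\<in>M 1. \<exists>c\<in>W 0. \<exists>e\<in>W 1. v = a + b + c + e"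
proof -
  have "\<exists>!(a, b, c, e). a \<in> M 0 \<and> b \<in> M 1 \<and> c \<in> W 0 \<and> e \<in> W 1 \<and> v = a + b + c + e"
    using graded_sum by (simp add: graded_sum_def)
  then show ?thesis by (auto dest!: ex1_implies_ex)
qed

lemma four_unique:
  assumes "a \<in> M 0" "b \<in> M 1" "c \<in> W 0" "e \<in> W 1" "a + b + c + e = 0"
  shows "a = 0" "b = 0" "c = 0" "e = 0"
proof -
  define P where "P = (\<lambda>(a, b, c, e). a \<in> M 0 \<and> b \<in> M 1 \<and> c \<in> W 0 \<and> e \<in> W 1 \<and> 0 = a + b + c + e)"
  have "\<exists>!x. P x"
    using graded_sum unfolding graded_sum_def P_def by blast
  moreover have "P (a, b, c, e)" "P (0, 0, 0, 0)"
    using assms subspace_0[OF sub_M] subspace_0[OF sub_W] by (simp_all add: P_def)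
  ultimately have "(a, b, c, e) = (0, 0, 0, 0)" by blast
  then show "a = 0" "b = 0" "c = 0" "e = 0" by auto
qed

lemma subspace_part: "subspace (part t)"
proof -
  have "part t = {x + y |x y. x \<in> (if t then M else W) 0 \<and> y \<in> (if t then M else W) 1}"
    by (rule set_eqI) (simp only: mem_part mem_Collect_eq, blast)
  then show ?thesis
    using subspace_sums[OF sub_M sub_M] subspace_sums[OF sub_W sub_W] by (cases t) simp_all
qed

lemma subspace_grade: "subspace (grade M W p)"
proof -
  have "grade M W p = {x + y |x y. x \<in> M p \<and> y \<in> W p}"
    by (rule set_eqI) (simp only: mem_grade mem_Collect_eq, blast)
  then show ?thesis
    using subspace_sums[OF sub_M sub_W] by simp
qed

lemma part_indep:
  assumes "x \<in> part True" "x \<in> part False"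
  shows "x = 0"
proof -
  obtain a b where ab: "a \<in> M 0" "b \<in> M 1" "x = a + b" using assms(1) by (auto simp: mem_part)
  obtain c e where ce: "c \<in> W 0" "e \<in> W 1" "x = c + e" using assms(2) by (auto simp: mem_part)
  have "- c \<in> W 0" "- e \<in> W 1" using ce sub_W subspace_neg by blast+
  moreover have "a + b + - c + - e = 0" using ab ce by (simp add: algebra_simps)
  ultimately have "a = 0" "b = 0" using four_unique ab by blast+
  then show ?thesis using ab by simp
qed

sublocale parity_grading "grade M W"
proof
  show "0 \<in> grade M W p" for p
    using subspace_0[OF subspace_grade] .
  show "x - y \<in> grade M W p" if "x \<in> grade M W p" "y \<in> grade M W p" for x y p
    using subspace_diff[OF subspace_grade that] .
  show "\<exists>a\<in>grade M W 0. \<exists>b\<in>grade M W 1. v = a + b" for v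
  proof -
    obtain a b c e where *: "a \<in> M 0" "b \<in> M 1" "c \<in> W 0" "e \<in> W 1" "v = a + b + c + e"
      using four_decomp by blast
    then have "v = (a + c) + (b + e)" by (simp add: algebra_simps)
    with * show ?thesis unfolding mem_grade Bex_def by blast
  qed
  show "x = 0" if x: "x \<in> grade M W 0" "x \<in> grade M W 1" for x
  proof -
    obtain a c where ac: "a \<in> M 0" "c \<in> W 0" "x = a + c" using x(1) by (auto simp: mem_grade)
    obtain b e where be: "b \<in> M 1" "e \<in> W 1" "x = b + e" using x(2) by (auto simp: mem_grade)
    have "- b \<in> M 1" "- e \<in> W 1" using be sub_M sub_W subspace_neg by blast+
    moreover have "a + - b + c + - e = 0" using ac be by (simp add: algebra_simps)
    ultimately have "a = 0" "c = 0" using four_unique ac by blast+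
    then show ?thesis using ac by simp
  qed
  show "v = 0" if "v + v = 0" for v :: 'v
  proof -
    have "scale (of_nat 2) v = 0"
      using that scale_left_distrib[of 1 1 v] by simp
    \<comment> \<open>A characteristic dividing the prime 2 is 1 or 2; the first is impossible in a
      field, the second is excluded.\<close>
    moreover have "\<not> CHAR('k) dvd 2"
      using char_neq_2 CHAR_not_1[where 'a='k] two_is_prime_nat by (auto simp: prime_nat_iff)
    then have "(of_nat 2 :: 'k) \<noteq> 0"
      unfolding of_nat_eq_0_iff_char_dvd .
    ultimately show ?thesis by simp
  qed
qed

abbreviation G where "G \<equiv> grade M W"

lemma M_W_grade: "x \<in> (if t then M else W) p \<Longrightarrow> x \<in> G p"
  using subspace_0[OF sub_M[of p]] subspace_0[OF sub_W[of p]] unfolding mem_grade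
  by (metis add.right_neutral add.left_neutral)

lemma component_part: "x \<in> part t \<Longrightarrow> component G p x \<in> part t"
proof -
  let ?X = "if t then M else W"
  assume "x \<in> part t"
  then obtain a b where ab: "a \<in> ?X 0" "b \<in> ?X 1" "x = a + b"
    by (auto simp only: mem_part)
  have sub: "subspace (?X p)" for p using sub_M sub_W by simp
  have "component G p x = (if p = 0 then a else b)"
    using M_W_grade[OF ab(1)] M_W_grade[OF ab(2)]
    by (auto simp: ab(3) component_add component_same component_other)
  moreover have "a + 0 \<in> part t" "0 + b \<in> part t"
    using ab subspace_0[OF sub, of 0] subspace_0[OF sub, of 1]
    unfolding mem_part by blast+
  ultimately show ?thesis by simp
qed

lemma sign_part: "x \<in> part t \<Longrightarrow> sign p x \<in> part t"
  using subspace_neg[OF subspace_part] by (simp add: sign_def)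

lemma koszul_part: "x \<in> part t \<Longrightarrow> koszul G q x \<in> part t"
  by (simp add: koszul_def subspace_add[OF subspace_part] sign_part component_part
      subspace_neg[OF subspace_part])

text \<open>Projections onto M and W. The last two clauses say that an argument already in M or W is
  expanded only into itself and 0.\<close>

lemma part_decomp:
  obtains f g where "\<And>x. x = f x + g x" "\<And>x. f x \<in> part True" "\<And>x. g x \<in> part False"
    "\<And>x. x \<in> part True \<Longrightarrow> f x = x \<and> g x = 0" "\<And>x. x \<in> part False \<Longrightarrow> f x = 0 \<and> g x = x"
proof -
  have "\<exists>m w. x = m + w \<and> m \<in> part True \<and> w \<in> part False" for x
  proof -
    obtain a b c e where *: "a \<in> M 0" "b \<in> M 1" "c \<in> W 0" "e \<in> W 1" "x = a + b + c + e"
      using four_decomp by blast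
    then have "x = (a + b) + (c + e)" "a + b \<in> part True" "c + e \<in> part False"
      by (auto simp: mem_part algebra_simps)
    then show ?thesis by blast
  qed
  then obtain f g where fg: "\<And>x. x = f x + g x" "\<And>x. f x \<in> part True" "\<And>x. g x \<in> part False"
    by metis
  have "f x = x \<and> g x = 0" if "x \<in> part True" for x
  proof -
    have "x - f x = g x" using fg(1)[of x] by (metis add_diff_cancel_left')
    then have "g x \<in> part True" using subspace_diff[OF subspace_part that fg(2)] by metis
    then have "g x = 0" using part_indep fg(3) by blast
    then show ?thesis using fg(1)[of x] by simp
  qed
  moreover have "f x = 0 \<and> g x = x" if "x \<in> part False" for x
  proof -
    have "x - g x = f x" using fg(1)[of x] by (metis add_diff_cancel_right')
    then have "f x \<in> part False" using subspace_diff[OF subspace_part that fg(3)] by metis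
    then have "f x = 0" using part_indep fg(2) by blast
    then show ?thesis using fg(1)[of x] by simp
  qed
  ultimately show thesis using that fg by blast
qed

text \<open>The word records the order in which elements of M and W occur. Unlike shuffles, such
  words can be cut and concatenated along with the argument list, as composition products
  require.\<close>

definition typed :: "bool list \<Rightarrow> 'v list \<Rightarrow> bool" where
  "typed = list_all2 (\<lambda>t v. v \<in> part t)"

definition bidegree :: "bool list \<Rightarrow> nat \<times> nat" where
  "bidegree ts = (count_list ts True, count_list ts False)"

lemma bidegree_append: "bidegree (ts @ us) = bidegree ts + bidegree us"
  by (simp add: bidegree_def)

lemma bidegree_simps [simp]: "bidegree [] = 0"
  "bidegree (t # ts) = (of_bool t, of_bool (\<not> t)) + bidegree ts"
  by (auto simp: bidegree_def zero_prod_def)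

lemma bidegree_length: "fst (bidegree ts) + snd (bidegree ts) = length ts"
  by (induction ts) auto

lemma typed_simps: "typed [] vs \<longleftrightarrow> vs = []" "typed ts [] \<longleftrightarrow> ts = []"
  "typed (t # ts) (v # vs) \<longleftrightarrow> v \<in> part t \<and> typed ts vs"
  by (simp_all add: typed_def)

lemma typed_length: "typed ts vs \<Longrightarrow> length ts = length vs"
  by (simp add: typed_def list_all2_lengthD)

lemma shuffles_typed:
  assumes "vs \<in> shuffles ms ws" "set ms \<subseteq> part True" "set ws \<subseteq> part False"
  shows "\<exists>ts. typed ts vs \<and> bidegree ts = (length ms, length ws)"
  using assms
proof (induction vs arbitrary: ms ws)
  case Nil
  then show ?case by (intro exI[of _ "[]"]) (auto simp: typed_simps zero_prod_def)
next
  case (Cons v vs)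
  then consider ms' where "ms = v # ms'" "vs \<in> shuffles ms' ws"
    | ws' where "ws = v # ws'" "vs \<in> shuffles ms ws'"
    by (auto simp: Cons_in_shuffles_iff neq_Nil_conv)
  then show ?case
  proof cases
    case 1
    then obtain ts where "typed ts vs" "bidegree ts = (length ms', length ws)"
      using Cons by fastforce
    then show ?thesis using 1 Cons.prems by (intro exI[of _ "True # ts"]) (auto simp: typed_simps)
  next
    case 2
    then obtain ts where "typed ts vs" "bidegree ts = (length ms, length ws')"
      using Cons by fastforce
    then show ?thesis using 2 Cons.prems by (intro exI[of _ "False # ts"]) (auto simp: typed_simps)
  qed
qed

lemma typed_shuffles:
  assumes "typed ts vs"
  shows "\<exists>ms ws. vs \<in> shuffles ms ws \<and> set ms \<subseteq> part True \<and> set ws \<subseteq> part False \<and>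
    bidegree ts = (length ms, length ws)"
  using assms unfolding typed_def
proof (induction rule: list_all2_induct)
  case Nil
  then show ?case by (intro exI[of _ "[]"]) (simp add: zero_prod_def)
next
  case (Cons t ts v vs)
  then obtain ms ws where *: "vs \<in> shuffles ms ws" "set ms \<subseteq> part True" "set ws \<subseteq> part False"
    "bidegree ts = (length ms, length ws)" by blast
  show ?case
  proof (cases t)
    case True
    then show ?thesis using * Cons
      by (intro exI[of _ "v # ms"] exI[of _ ws]) (auto intro: Cons_in_shuffles_leftI)
  next
    case False
    then show ?thesis using * Cons
      by (intro exI[of _ ms] exI[of _ "v # ws"]) (auto intro: Cons_in_shuffles_rightI)
  qed
qed

lemma tensors_iff: "vs \<in> tensors M W k l \<longleftrightarrow> (\<exists>ts. typed ts vs \<and> bidegree ts = (k, l))"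
proof -
  have eq: "total M = part True" "total W = part False" by (simp_all add: part_def)
  show ?thesis
  proof
    assume "vs \<in> tensors M W k l"
    then show "\<exists>ts. typed ts vs \<and> bidegree ts = (k, l)"
      unfolding tensors_def eq using shuffles_typed by fastforce
  next
    assume "\<exists>ts. typed ts vs \<and> bidegree ts = (k, l)"
    then show "vs \<in> tensors M W k l"
      unfolding tensors_def eq using typed_shuffles by fastforce
  qed
qed

lemma Hom_T_iff: "\<phi> \<in> Hom_T scale M W k l N \<longleftrightarrow> multilinear scale \<phi> \<and> range \<phi> \<subseteq> N \<and>
    (\<forall>ts vs. typed ts vs \<longrightarrow> bidegree ts \<noteq> (k, l) \<longrightarrow> \<phi> vs = 0)"
  unfolding Hom_T_def mem_Collect_eq Ball_def tensors_iff
  by (auto simp: prod_eq_iff) (metis prod.collapse)+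

lemma multilinear_additive: "multilinear scale \<phi> \<Longrightarrow> multi_additive \<phi>"
  by (simp add: multilinear_def multi_additive_def linear_iff)

lemma Hom_T_additive: "\<phi> \<in> Hom_T scale M W k l N \<Longrightarrow> multi_additive \<phi>"
  by (simp add: Hom_T_iff multilinear_additive)

text \<open>Expansion along V = M + W. The second premise on \<open>ys\<close> remembers that an
  argument lying in M or W is either kept or replaced by 0; \<open>Hom_T_zero_arg\<close> depends on
  this.\<close>

lemma Hom_T_vanish:
  assumes "multi_additive \<phi>"
    and "\<And>ts ys. typed ts ys \<Longrightarrow> list_all2 (\<lambda>x y. \<forall>t. x \<in> part t \<longrightarrow> y = 0 \<or> y = x) vs ys \<Longrightarrow> \<phi> ys = 0"
  shows "\<phi> vs = 0"
proof -
  obtain f g where fg: "\<And>x. x = f x + g x" "\<And>x. f x \<in> part True" "\<And>x. g x \<in> part False"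
    "\<And>x. x \<in> part True \<Longrightarrow> f x = x \<and> g x = 0" "\<And>x. x \<in> part False \<Longrightarrow> f x = 0 \<and> g x = x"
    by (rule part_decomp) blast
  show ?thesis
  proof (rule multi_additive_eq_zero[OF assms(1) fg(1)])
    fix ys assume ys: "list_all2 (\<lambda>x y. y = f x \<or> y = g x) vs ys"
    have "\<exists>ts. typed ts ys"
      using ys
    proof (induction rule: list_all2_induct)
      case Nil
      then show ?case by (auto simp: typed_simps)
    next
      case (Cons x xs y ys)
      then obtain ts t where "typed ts ys" "y \<in> part t" using fg(2,3) by metis
      then show ?case by (intro exI[of _ "t # ts"]) (simp add: typed_simps)
    qed
    then obtain ts where "typed ts ys" by blast
    moreover have "list_all2 (\<lambda>x y. \<forall>t. x \<in> part t \<longrightarrow> y = 0 \<or> y = x) vs ys"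
      using ys by (rule list_all2_mono) (metis (full_types) fg(4,5))
    ultimately show "\<phi> ys = 0" by (rule assms(2))
  qed
qed

lemma Hom_T_of_arity:
  assumes "\<phi> \<in> Hom_T scale M W k l N"
  shows "of_arity (k + l) \<phi>"
  unfolding of_arity_def
proof (intro allI impI)
  fix vs :: "'v list" assume len: "length vs \<noteq> k + l"
  show "\<phi> vs = 0"
  proof (rule Hom_T_vanish[OF Hom_T_additive[OF assms]])
    fix ts ys assume *: "typed ts ys" "list_all2 (\<lambda>x y. \<forall>t. x \<in> part t \<longrightarrow> y = 0 \<or> y = x) vs ys"
    have "length ts = length vs" using typed_length[OF *(1)] list_all2_lengthD[OF *(2)] by simp
    then have "bidegree ts \<noteq> (k, l)" using len bidegree_length[of ts] by auto
    then show "\<phi> ys = 0" using assms * by (simp add: Hom_T_iff)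
  qed
qed

text \<open>The other arguments are arbitrary, so they are expanded; every resulting word still
  contains the forbidden type \<open>t\<close>, unless \<open>v\<close> was replaced by 0.\<close>

lemma Hom_T_zero_arg:
  assumes "\<phi> \<in> Hom_T scale M W k l N" "v \<in> part t" "(if t then k else l) = 0"
  shows "\<phi> (us @ v # ws) = 0"
proof (rule Hom_T_vanish[OF Hom_T_additive[OF assms(1)]])
  fix ts ys assume *: "typed ts ys"
    "list_all2 (\<lambda>x y. \<forall>t. x \<in> part t \<longrightarrow> y = 0 \<or> y = x) (us @ v # ws) ys"
  then obtain us' y ws' where ys: "ys = us' @ y # ws'" "y = 0 \<or> y = v"
    using assms(2) by (auto simp: list_all2_append1 list_all2_Cons1)
  show "\<phi> ys = 0"
  proof (cases "y = 0")
    case True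
    then show ?thesis
      using multi_additive_simps(1)[OF Hom_T_additive[OF assms(1)]] ys by simp
  next
    case False
    then have y: "y \<in> part t" using ys assms(2) by simp
    obtain ts1 t' ts2 where ts: "ts = ts1 @ t' # ts2" "y \<in> part t'"
      using *(1) ys by (auto simp: typed_def list_all2_append2 list_all2_Cons2)
    \<comment> \<open>A nonzero element has only one type.\<close>
    then have "t' = t" using False y part_indep by (cases t; cases t') auto
    then have "bidegree ts \<noteq> (k, l)"
      using assms(3) ts by (auto simp: bidegree_append plus_prod_def split: if_splits)
    then show ?thesis using assms(1) * by (simp add: Hom_T_iff)
  qed
qed

lemma Hom_T_eq_zero:
  assumes "\<phi> \<in> Hom_T scale M W k l N" "\<And>ts vs. typed ts vs \<Longrightarrow> bidegree ts = (k, l) \<Longrightarrow> \<phi> vs = 0"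
  shows "\<phi> = 0"
proof
  fix vs
  have "\<phi> ys = 0" if "typed ts ys" for ts ys
    using assms that unfolding Hom_T_iff by metis
  then show "\<phi> vs = 0 vs"
    using Hom_T_vanish[OF Hom_T_additive[OF assms(1)]] by simp
qed

text \<open>On inputs of bidegree (k, l) only \<phi> contributes, and \<phi> is determined by its
  values there.\<close>

lemma Hom_T_sum_eq_zero:
  assumes "\<phi> \<in> Hom_T scale M W k l N" "\<phi> + \<chi> = 0"
    and "\<And>ts vs. typed ts vs \<Longrightarrow> bidegree ts = (k, l) \<Longrightarrow> \<chi> vs = 0"
  shows "\<phi> = 0"
proof (rule Hom_T_eq_zero[OF assms(1)])
  fix ts vs assume *: "typed ts vs" "bidegree ts = (k, l)"
  have "\<phi> vs + \<chi> vs = 0" using assms(2) by (metis plus_fun_apply zero_fun_apply)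
  then show "\<phi> vs = 0" using assms(3)[OF *] by simp
qed

section \<open>Multilinearity of products and parity parts\<close>

lemma linear_sum: "(\<And>i. i \<in> I \<Longrightarrow> Vector_Spaces.linear scale scale (f i)) \<Longrightarrow>
    Vector_Spaces.linear scale scale (\<lambda>v. \<Sum>i\<in>I. f i v)"
  by (simp add: linear_iff sum.distrib scale_sum_right)

lemma linear_comp: "Vector_Spaces.linear scale scale f \<Longrightarrow> Vector_Spaces.linear scale scale g \<Longrightarrow>
    Vector_Spaces.linear scale scale (\<lambda>v. f (g v))"
  by (simp add: linear_iff)

lemma linear_sign: "Vector_Spaces.linear scale scale f \<Longrightarrow>
    Vector_Spaces.linear scale scale (\<lambda>v. sign p (f v))"
  by (simp add: linear_iff sign_def)

lemma linear_component: "Vector_Spaces.linear scale scale (component G p)"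
proof -
  have "component G p (scale r v) = scale r (component G p v)" for r v
  proof -
    have "scale r v = scale r (component G p v) + scale r (component G (p + 1) v)"
      by (simp only: component_sum' flip: scale_right_distrib)
    then show ?thesis
      using component_eq[OF subspace_scale[OF subspace_grade component_mem]
          subspace_scale[OF subspace_grade component_mem]] by metis
  qed
  then show ?thesis by (simp add: linear_iff component_add)
qed

lemma linear_koszul: "Vector_Spaces.linear scale scale (koszul G q)"
  unfolding koszul_def[abs_def] by (intro linear_sum linear_sign linear_component)

lemma linear_diff: "Vector_Spaces.linear scale scale f \<Longrightarrow> Vector_Spaces.linear scale scale g \<Longrightarrow>
    Vector_Spaces.linear scale scale (\<lambda>v. f v - g v)"
  by (simp add: linear_iff scale_right_diff_distrib)

lemma multilinearD: "multilinear scale \<phi> \<Longrightarrow> Vector_Spaces.linear scale scale (\<lambda>v. \<phi> (us @ v # ws))"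
  by (simp add: multilinear_def)

lemma multilinear_circ:
  assumes "multilinear scale \<phi>" "multilinear scale \<chi>"
  shows "multilinear scale (circ G q \<phi> \<chi>)"
  unfolding multilinear_def circ_def
proof (intro allI)
  fix us ws :: "'v list"
  let ?term = "\<lambda>i l vs. \<phi> (map (koszul G q) (take i vs) @ [\<chi> (take l (drop i vs))] @ drop (i + l) vs)"
  have "Vector_Spaces.linear scale scale (\<lambda>v. ?term i l (us @ v # ws))" for i l
  proof -
    \<comment> \<open>The varying argument \<open>v\<close> stands to the left of \<chi>, among its
      inputs, or to its right. In the first two cases \<open>Suc j\<close> counts \<open>v\<close>
      together with the first \<open>j\<close> entries of \<open>ws\<close>.\<close>
    consider "length us < i" | "i \<le> length us" "length us < i + l" | "i + l \<le> length us" by linarith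
    then show ?thesis
    proof cases
      case 1
      then obtain j where j: "i = length us + Suc j" by (metis add_Suc_right less_iff_Suc_add)
      have "(\<lambda>v. ?term i l (us @ v # ws)) = (\<lambda>v. \<phi> (map (koszul G q) us @ koszul G q v #
          (map (koszul G q) (take j ws) @ [\<chi> (take l (drop j ws))] @ drop (j + l) ws)))"
        by (simp add: j)
      then show ?thesis using linear_comp[OF multilinearD[OF assms(1)] linear_koszul] by simp
    next
      case 2
      then obtain j where "i + l = length us + Suc j" by (metis add_Suc_right less_iff_Suc_add)
      then have j: "i + l - length us = Suc j" "l - (length us - i) = Suc j" using 2 by linarith+
      have drop: "drop (i + l) (us @ v # ws) = drop j ws"
        and take: "take l (drop i (us @ v # ws)) = drop i us @ v # take j ws" for v
        using 2 j by simp_all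
      have "(\<lambda>v. ?term i l (us @ v # ws)) = (\<lambda>v. \<phi> (map (koszul G q) (take i us) @
          \<chi> (drop i us @ v # take j ws) # drop j ws))"
        unfolding drop take using 2 by simp
      then show ?thesis
        using linear_comp[OF multilinearD[OF assms(1)] multilinearD[OF assms(2)]] by simp
    next
      case 3
      have "(\<lambda>v. ?term i l (us @ v # ws)) = (\<lambda>v. \<phi> ((map (koszul G q) (take i us) @
          [\<chi> (take l (drop i us))] @ drop (i + l) us) @ v # ws))"
        using 3 by simp
      then show ?thesis by (simp only: multilinearD[OF assms(1)])
    qed
  qed
  then show "Vector_Spaces.linear scale scale (\<lambda>v. \<Sum>i\<in>{0..length (us @ v # ws)}.
      \<Sum>l\<in>{0..length (us @ v # ws) - i}. ?term i l (us @ v # ws))"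
    unfolding length_append list.size by (intro linear_sum)
qed

lemma multilinear_parity_part:
  assumes "multilinear scale \<phi>"
  shows "multilinear scale (parity_part G q \<phi>)"
  unfolding multilinear_def parity_part_def length_append list.size
proof (intro allI linear_sum)
  fix us ws :: "'v list" and ps :: "bit list"
  let ?c = "component G" and ?n = "length us"
  assume "ps \<in> {ps. length ps = ?n + (length ws + Suc 0)}"
  then have ps: "length ps = ?n + (length ws + Suc 0)" by simp
  have "map2 ?c ps (us @ v # ws) =
      map2 ?c (take ?n ps) us @ ?c (ps ! ?n) v # map2 ?c (drop (Suc ?n) ps) ws" for v
  proof -
    \<comment> \<open>The parity pattern is cut at the position of the varying argument.\<close>
    have "ps = take ?n ps @ ps ! ?n # drop (Suc ?n) ps" using ps by (intro id_take_nth_drop) simp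
    then have "zip ps (us @ v # ws) = zip (take ?n ps @ ps ! ?n # drop (Suc ?n) ps) (us @ v # ws)" by simp
    also have "\<dots> = zip (take ?n ps) us @ (ps ! ?n, v) # zip (drop (Suc ?n) ps) ws"
      using ps by (subst zip_append) simp_all
    finally show ?thesis by simp
  qed
  then show "Vector_Spaces.linear scale scale
      (\<lambda>v. ?c (q + sum_list ps) (\<phi> (map2 ?c ps (us @ v # ws))))"
    by (simp only:)
       (rule linear_comp[OF linear_component linear_comp[OF multilinearD[OF assms] linear_component]])
qed

section \<open>Closure properties of \<open>Hom_T\<close>\<close>

lemma Hom_T_zero: "subspace N \<Longrightarrow> 0 \<in> Hom_T scale M W k l N"
  using subspace_0 by (auto simp: Hom_T_iff multilinear_def linear_iff)

lemma Hom_T_add: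
  assumes "subspace N" "\<phi> \<in> Hom_T scale M W k l N" "\<chi> \<in> Hom_T scale M W k l N"
  shows "\<phi> + \<chi> \<in> Hom_T scale M W k l N"
  using assms subspace_add[OF assms(1)] unfolding Hom_T_iff multilinear_def linear_iff
  by (auto simp: scale_right_distrib image_subset_iff algebra_simps)

lemma Hom_T_minus:
  assumes "subspace N" "\<phi> \<in> Hom_T scale M W k l N"
  shows "- \<phi> \<in> Hom_T scale M W k l N"
  using assms subspace_neg[OF assms(1)] unfolding Hom_T_iff multilinear_def linear_iff
  by (auto simp: image_subset_iff algebra_simps)

lemma Hom_T_diff:
  assumes "subspace N" "\<phi> \<in> Hom_T scale M W k l N" "\<chi> \<in> Hom_T scale M W k l N"
  shows "\<phi> - \<chi> \<in> Hom_T scale M W k l N"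
  using Hom_T_add[OF assms(1,2) Hom_T_minus[OF assms(1,3)]] by simp

lemma Hom_T_sign:
  assumes "subspace N" "\<phi> \<in> Hom_T scale M W k l N"
  shows "(\<lambda>vs. sign p (\<phi> vs)) \<in> Hom_T scale M W k l N"
proof -
  have "(\<lambda>vs. sign p (\<phi> vs)) = (if p = 0 then \<phi> else - \<phi>)"
    by (auto simp: sign_def)
  then show ?thesis using assms Hom_T_minus by simp
qed

lemma typed_map: "typed ts vs \<Longrightarrow> (\<And>t x. x \<in> part t \<Longrightarrow> f x \<in> part t) \<Longrightarrow> typed ts (map f vs)"
  by (auto simp: typed_def list_all2_map2 elim: list_all2_mono)

lemma typed_append: "typed ts vs \<Longrightarrow> typed us ws \<Longrightarrow> typed (ts @ us) (vs @ ws)"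
  by (simp add: typed_def list_all2_appendI)

lemma typed_components:
  assumes "typed ts vs" "length ps = length vs"
  shows "typed ts (map2 (component G) ps vs)"
  using assms component_part by (auto simp: typed_def list_all2_conv_all_nth)

lemma sum_part: "(\<And>i. i \<in> I \<Longrightarrow> f i \<in> part t) \<Longrightarrow> sum f I \<in> part t"
  by (rule subspace_sum[OF subspace_part])

lemma parity_part_Hom_T:
  assumes "\<phi> \<in> Hom_T scale M W k l (part t)"
  shows "parity_part G q \<phi> \<in> Hom_T scale M W k l (part t)"
  unfolding Hom_T_iff
proof (intro conjI allI impI)
  show "multilinear scale (parity_part G q \<phi>)"
    using assms multilinear_parity_part by (simp add: Hom_T_iff)
  show "range (parity_part G q \<phi>) \<subseteq> part t"
    using assms unfolding parity_part_def[abs_def] Hom_T_iff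
    by (auto intro!: sum_part component_part)
  fix ts vs assume "typed ts vs" "bidegree ts \<noteq> (k, l)"
  then have "\<phi> (map2 (component G) ps vs) = 0" if "length ps = length vs" for ps
    using assms typed_components[OF _ that] unfolding Hom_T_iff by blast
  then show "parity_part G q \<phi> vs = 0"
    unfolding parity_part_def by (intro sum.neutral) (simp add: component_simps)
qed

text \<open>\<chi> consumes inputs of bidegree (k', l') and returns one element of type
  \<open>t\<close>. The resulting balance of bidegrees is written as a sum on both sides to avoid
  subtraction.\<close>

lemma circ_Hom_T:
  assumes "\<phi> \<in> Hom_T scale M W k l N" "\<chi> \<in> Hom_T scale M W k' l' (part t)" "subspace N"
    and "(k, l) + (k', l') = (K, L) + (of_bool t, of_bool (\<not> t))"
  shows "circ G q \<phi> \<chi> \<in> Hom_T scale M W K L N"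
  unfolding Hom_T_iff
proof (intro conjI allI impI)
  show "multilinear scale (circ G q \<phi> \<chi>)"
    using assms multilinear_circ by (simp add: Hom_T_iff)
  show "range (circ G q \<phi> \<chi>) \<subseteq> N"
    using assms(1) unfolding circ_def[abs_def] Hom_T_iff
    by (auto intro!: subspace_sum[OF assms(3)])
  fix ts vs assume ts: "typed ts vs" "bidegree ts \<noteq> (K, L)"
  show "circ G q \<phi> \<chi> vs = 0"
    unfolding circ_def
  proof (intro sum.neutral ballI)
    fix i j assume "i \<in> {0..length vs}" "j \<in> {0..length vs - i}"
    let ?mid = "take j (drop i vs)" and ?tmid = "take j (drop i ts)"
    have mid: "typed ?tmid ?mid" and left: "typed (take i ts) (take i vs)"
      and right: "typed (drop (i + j) ts) (drop (i + j) vs)"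
      using ts(1) by (simp_all add: typed_def)
    have "ts = take i ts @ ?tmid @ drop (i + j) ts"
      by (metis append_take_drop_id drop_drop add.commute)
    then have deg: "bidegree ts = bidegree (take i ts) + (bidegree ?tmid + bidegree (drop (i + j) ts))"
      by (metis bidegree_append)
    show "\<phi> (map (koszul G q) (take i vs) @ [\<chi> ?mid] @ drop (i + j) vs) = 0"
    \<comment> \<open>Either \<chi> vanishes on its block, or replacing the block by the single
      letter \<open>t\<close> leaves a word of bidegree other than (k, l), on which \<phi>
      vanishes.\<close>
    proof (cases "bidegree ?tmid = (k', l')")
      case False
      then have "\<chi> ?mid = 0" using assms(2) mid by (simp add: Hom_T_iff)
      then show ?thesis using multi_additive_simps(1)[OF Hom_T_additive[OF assms(1)]] by simp
    next
      case True
      let ?ts = "take i ts @ [t] @ drop (i + j) ts"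
      have "\<chi> ?mid \<in> part t" using assms(2) by (auto simp: Hom_T_iff)
      then have "typed ?ts (map (koszul G q) (take i vs) @ [\<chi> ?mid] @ drop (i + j) vs)"
        using left right typed_map koszul_part by (intro typed_append) (auto simp: typed_simps)
      moreover have "bidegree ?ts \<noteq> (k, l)"
        using ts(2) True assms(4) unfolding deg bidegree_append
        by (auto simp: prod_eq_iff zero_prod_def)
      ultimately show ?thesis using assms(1) unfolding Hom_T_iff by blast
    qed
  qed
qed

text \<open>The output of \<chi> has a type that \<phi> does not accept. This removes \<delta>
  \<circ> \<phi> for all M-valued \<phi>, and \<mu> \<circ> \<delta>.\<close>

lemma circ_Hom_T_zero:
  assumes "\<phi> \<in> Hom_T scale M W k l N" "\<chi> \<in> Hom_T scale M W k' l' (part t)" "(if t then k else l) = 0"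
  shows "circ G q \<phi> \<chi> = 0"
  using assms(2) by (intro circ_eq_zero Hom_T_zero_arg[OF assms(1) _ assms(3)]) (auto simp: Hom_T_iff)

section \<open>Additivity and parity of the bracket\<close>

lemma bracket_parts:
  "bracket G \<phi> \<chi> = (\<lambda>vs. \<Sum>p\<in>{0, 1}. \<Sum>q\<in>{0, 1}. circ G q (parity_part G p \<phi>) (parity_part G q \<chi>) vs
        - sign (p * q) (circ G p (parity_part G q \<chi>) (parity_part G p \<phi>) vs))"
  by (rule ext) (rule bracket_def)

lemma bracket_add_right:
  assumes "multilinear scale \<phi>"
  shows "bracket G \<phi> (\<chi> + \<chi>') = bracket G \<phi> \<chi> + bracket G \<phi> \<chi>'"
  using multilinear_additive[OF multilinear_parity_part[OF assms]]
  by (simp add: bracket_parts fun_eq_iff parity_part_add circ_add_left circ_add_right sign_add)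

lemma bracket_add_left:
  assumes "multilinear scale \<chi>"
  shows "bracket G (\<phi> + \<phi>') \<chi> = bracket G \<phi> \<chi> + bracket G \<phi>' \<chi>"
  using multilinear_additive[OF multilinear_parity_part[OF assms]]
  by (simp add: bracket_parts fun_eq_iff parity_part_add circ_add_left circ_add_right sign_add)

lemmas bracket_additive =
  additiveD[of "bracket G \<phi>" for \<phi>, OF bracket_add_right]

lemma multilinear_bracket:
  assumes "multilinear scale \<phi>" "multilinear scale \<chi>"
  shows "multilinear scale (bracket G \<phi> \<chi>)"
proof -
  have "multilinear scale (circ G r (parity_part G p \<phi>) (parity_part G q \<chi>))"
    "multilinear scale (circ G r (parity_part G q \<chi>) (parity_part G p \<phi>))" for p q r
    using assms by (auto intro: multilinear_circ multilinear_parity_part)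
  then show ?thesis
    unfolding multilinear_def bracket_parts
    by (intro allI linear_sum linear_diff linear_sign) auto
qed

lemma has_parity_bracket:
  assumes "multilinear scale \<phi>" "multilinear scale \<chi>" "has_parity G p \<phi>" "has_parity G q \<chi>"
  shows "has_parity G (p + q) (bracket G \<phi> \<chi>)"
proof -
  note ma = multilinear_additive[OF assms(1)] multilinear_additive[OF assms(2)]
  have "has_parity G (p + q) (circ G q \<phi> \<chi>)"
    using s_circ[OF ma assms(3,4)] multilinear_additive[OF multilinear_circ[OF assms(1,2)]]
    by (simp only: has_parity_iff simp_thms)
  moreover have "has_parity G (p + q) (circ G p \<chi> \<phi>)"
    using s_circ[OF ma(2,1) assms(4,3)] multilinear_additive[OF multilinear_circ[OF assms(2,1)]]
    by (simp only: has_parity_iff simp_thms add.commute[of q p])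
  ultimately have "has_parity G (p + q) (circ G q \<phi> \<chi> - (\<lambda>vs. sign (p * q) (circ G p \<chi> \<phi> vs)))"
    by (intro has_parity_minus has_parity_sign)
  moreover have "bracket G \<phi> \<chi> = circ G q \<phi> \<chi> - (\<lambda>vs. sign (p * q) (circ G p \<chi> \<phi> vs))"
    using bracket_homogeneous[OF ma assms(3,4)] by (simp add: fun_eq_iff)
  ultimately show ?thesis by simp
qed

text \<open>The bracket with the part of opposite parity has parity p + q + 1, yet it is also a
  difference of two cochains of parity p + q, hence zero. This is how a homogeneous primitive
  replaces an arbitrary one.\<close>

lemma bracket_parity_part:
  assumes "multilinear scale \<phi>" "multilinear scale \<chi>" "has_parity G p \<phi>"
    and "has_parity G (p + q) (bracket G \<phi> \<chi>)"
  shows "bracket G \<phi> (parity_part G q \<chi>) = bracket G \<phi> \<chi>"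
proof -
  let ?a = "parity_part G q \<chi>" and ?b = "parity_part G (q + 1) \<chi>"
  note ml = multilinear_parity_part[OF assms(2)]
  note par = has_parity_part[OF multilinear_additive[OF assms(2)]]
  have sum: "bracket G \<phi> \<chi> = bracket G \<phi> ?a + bracket G \<phi> ?b"
    using bracket_add_right[OF assms(1)] parity_part_sum[OF multilinear_additive[OF assms(2)]] by metis
  then have b: "bracket G \<phi> ?b = bracket G \<phi> \<chi> - bracket G \<phi> ?a" by simp
  have "multi_additive (bracket G \<phi> ?b)"
    by (intro multilinear_additive multilinear_bracket assms(1) ml)
  moreover have "has_parity G (p + q) (bracket G \<phi> ?b)"
    unfolding b using has_parity_bracket[OF assms(1) ml assms(3) par] assms(4) has_parity_minus by blast
  moreover have "has_parity G (p + q + 1) (bracket G \<phi> ?b)"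
    using has_parity_bracket[OF assms(1) ml assms(3) par, of "q + 1"] by (simp add: add.assoc)
  ultimately have "bracket G \<phi> ?b = 0" by (rule has_parity_unique)
  then show ?thesis using sum by simp
qed

end

section \<open>Brackets with odd binary cochains\<close>

lemma multi_additive_arity2I:
  assumes "of_arity 2 \<phi>" "\<And>x x' y. \<phi> [x + x', y] = \<phi> [x, y] + \<phi> [x', y]"
    "\<And>x y y'. \<phi> [x, y + y'] = \<phi> [x, y] + \<phi> [x, y']"
  shows "multi_additive \<phi>"
  unfolding multi_additive_def
proof (intro allI)
  fix us ws x y
  show "\<phi> (us @ (x + y) # ws) = \<phi> (us @ x # ws) + \<phi> (us @ y # ws)"
  proof (cases "length us + length ws = 1")
    case True
    then consider y where "us = []" "ws = [y]" | x where "us = [x]" "ws = []"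
      by (auto simp: add_is_1 length_Suc_conv)
    then show ?thesis by cases (simp_all add: assms)
  next
    case False
    then show ?thesis using assms(1) by (simp add: of_arity_def)
  qed
qed

context parity_grading
begin

lemma bracket_odd:
  assumes "multi_additive \<alpha>" "has_parity G 1 \<alpha>" "multi_additive \<chi>" "has_parity G q \<chi>"
  shows "bracket G \<alpha> \<chi> vs = circ G q \<alpha> \<chi> vs - sign q (circ G 1 \<chi> \<alpha> vs)"
  using bracket_homogeneous[OF assms(1,3,2,4)] by simp

lemma of_arity_bracket:
  assumes "multi_additive \<alpha>" "has_parity G 1 \<alpha>" "of_arity 2 \<alpha>"
    and "multi_additive \<chi>" "has_parity G q \<chi>" "of_arity n \<chi>"
  shows "of_arity (n + 1) (bracket G \<alpha> \<chi>)"
  unfolding of_arity_def bracket_odd[OF assms(1,2,4,5)]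
  using of_arity_circ[OF assms(1,3,6)] of_arity_circ[OF assms(4,6,3)]
  by (simp add: of_arity_def)

text \<open>This formula and the next two are the Hochschild coboundaries in low degree, with the
  signs of the parity-reversed convention.\<close>

lemma bracket_arity1:
  assumes "multi_additive \<alpha>" "has_parity G 1 \<alpha>" "of_arity 2 \<alpha>"
    and "multi_additive \<beta>" "has_parity G 0 \<beta>" "of_arity 1 \<beta>"
  shows "bracket G \<alpha> \<beta> [x, y] = \<alpha> [\<beta> [x], y] + \<alpha> [x, \<beta> [y]] - \<beta> [\<alpha> [x, y]]"
  by (simp add: bracket_odd[OF assms(1,2,4,5)] circ_2_1[OF assms(1,3,6)] circ_1_2[OF assms(4,3)])

lemma bracket_arity2:
  assumes "multi_additive \<alpha>" "has_parity G 1 \<alpha>" "of_arity 2 \<alpha>"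
    and "multi_additive \<chi>" "has_parity G 1 \<chi>" "of_arity 2 \<chi>"
  shows "bracket G \<alpha> \<chi> [x, y, z] =
    \<alpha> [\<chi> [x, y], z] + \<alpha> [s x, \<chi> [y, z]] + (\<chi> [\<alpha> [x, y], z] + \<chi> [s x, \<alpha> [y, z]])"
  by (simp add: bracket_odd[OF assms(1,2,4,5)] circ_2_2[OF assms(1,6)] circ_2_2[OF assms(4,3)])

lemma bracket_arity3:
  assumes "multi_additive \<alpha>" "has_parity G 1 \<alpha>" "of_arity 2 \<alpha>"
    and "multi_additive \<chi>" "has_parity G 0 \<chi>" "of_arity 3 \<chi>"
  shows "bracket G \<alpha> \<chi> [x, y, z, w] = \<alpha> [\<chi> [x, y, z], w] + \<alpha> [x, \<chi> [y, z, w]]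
    - (\<chi> [\<alpha> [x, y], z, w] + \<chi> [s x, \<alpha> [y, z], w] + \<chi> [s x, s y, \<alpha> [z, w]])"
  by (simp add: bracket_odd[OF assms(1,2,4,5)] circ_2_3[OF assms(1,6)] circ_3_2[OF assms(4,3)])

lemma double_eq_0_iff: "v + v = 0 \<longleftrightarrow> v = (0::'v)"
  by (rule iffI, erule no_2_torsion) simp

text \<open>The self-bracket of an odd cochain is twice its associator, and the factor 2 can be
  cancelled.\<close>

lemma bracket_self_eq_zero_iff:
  assumes "multi_additive \<alpha>" "has_parity G 1 \<alpha>" "of_arity 2 \<alpha>"
  shows "bracket G \<alpha> \<alpha> = 0 \<longleftrightarrow> (\<forall>x y z. \<alpha> [\<alpha> [x, y], z] + \<alpha> [s x, \<alpha> [y, z]] = 0)"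
proof -
  have "bracket G \<alpha> \<alpha> = 0 \<longleftrightarrow> (\<forall>x y z. bracket G \<alpha> \<alpha> [x, y, z] = 0)"
    using of_arity_eqI[of 3 "bracket G \<alpha> \<alpha>" 0] of_arity_bracket[OF assms assms]
    by (auto simp: of_arity_zero length_eq_3)
  then show ?thesis
    by (simp only: bracket_arity2[OF assms assms] double_eq_0_iff)
qed

end

context graded_pair
begin

lemma bracket_bracket_arity1:
  assumes \<alpha>: "multilinear scale \<alpha>" "has_parity G 1 \<alpha>" "of_arity 2 \<alpha>" "bracket G \<alpha> \<alpha> = 0"
    and \<beta>: "multilinear scale \<beta>" "has_parity G 0 \<beta>" "of_arity 1 \<beta>"
  shows "bracket G \<alpha> (bracket G \<alpha> \<beta>) = 0"
proof -
  note A = multilinear_additive[OF \<alpha>(1)] \<alpha>(2,3)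
  note B = multilinear_additive[OF \<beta>(1)] \<beta>(2,3)
  let ?\<gamma> = "bracket G \<alpha> \<beta>"
  have C: "multi_additive ?\<gamma>" "has_parity G 1 ?\<gamma>" "of_arity 2 ?\<gamma>"
    using multilinear_additive[OF multilinear_bracket[OF \<alpha>(1) \<beta>(1)]]
      has_parity_bracket[OF \<alpha>(1) \<beta>(1) \<alpha>(2) \<beta>(2)] of_arity_bracket[OF A B]
    by (simp_all add: numeral_2_eq_2)
  \<comment> \<open>Used as a rewrite rule, associativity moves nested products into the second
    slot, after which the terms of the expansion cancel.\<close>
  have "\<alpha> [\<alpha> [x, y], z] = - \<alpha> [s x, \<alpha> [y, z]]" for x y z
    using bracket_self_eq_zero_iff[OF A] \<alpha>(4) by (simp add: eq_neg_iff_add_eq_0)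
  moreover have "\<beta> [s x] = s (\<beta> [x])" for x
    using has_parityD[OF B(1,2), of "[x]"] by simp
  ultimately have "bracket G \<alpha> ?\<gamma> [x, y, z] = 0" for x y z
    by (simp add: bracket_arity2[OF A C] bracket_arity1[OF A B] multi_additive_args[OF A(1)]
        multi_additive_args[OF B(1)])
  then show ?thesis
    using of_arity_bracket[OF A C]
    by (intro of_arity_eqI[of 3]) (auto simp: of_arity_zero length_eq_3)
qed

lemma bracket_bracket_arity2:
  assumes \<alpha>: "multilinear scale \<alpha>" "has_parity G 1 \<alpha>" "of_arity 2 \<alpha>" "bracket G \<alpha> \<alpha> = 0"
    and \<beta>: "multilinear scale \<beta>" "has_parity G 1 \<beta>" "of_arity 2 \<beta>"
  shows "bracket G \<alpha> (bracket G \<alpha> \<beta>) = 0"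
proof -
  note A = multilinear_additive[OF \<alpha>(1)] \<alpha>(2,3)
  note B = multilinear_additive[OF \<beta>(1)] \<beta>(2,3)
  let ?\<gamma> = "bracket G \<alpha> \<beta>"
  have C: "multi_additive ?\<gamma>" "has_parity G 0 ?\<gamma>" "of_arity 3 ?\<gamma>"
    using multilinear_additive[OF multilinear_bracket[OF \<alpha>(1) \<beta>(1)]]
      has_parity_bracket[OF \<alpha>(1) \<beta>(1) \<alpha>(2) \<beta>(2)] of_arity_bracket[OF A B]
    by simp_all
  have "\<alpha> [\<alpha> [x, y], z] = - \<alpha> [s x, \<alpha> [y, z]]" for x y z
    using bracket_self_eq_zero_iff[OF A] \<alpha>(4) by (simp add: eq_neg_iff_add_eq_0)
  \<comment> \<open>Oriented inwards, these rules leave \<open>s\<close> only on single arguments,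
    so that the terms become comparable.\<close>
  moreover have "s (\<alpha> [x, y]) = - \<alpha> [s x, s y]" "s (\<beta> [x, y]) = - \<beta> [s x, s y]" for x y
    using has_parityD[OF A(1,2), of "[x, y]"] has_parityD[OF B(1,2), of "[x, y]"] by simp_all
  ultimately have "bracket G \<alpha> ?\<gamma> [x, y, z, w] = 0" for x y z w
    by (simp add: bracket_arity3[OF A C] bracket_arity2[OF A B] multi_additive_args[OF A(1)]
        multi_additive_args[OF B(1)])
  moreover have "of_arity 4 (bracket G \<alpha> ?\<gamma>)"
    using of_arity_bracket[OF A C] by simp
  ultimately show ?thesis
    by (intro of_arity_eqI[of 4]) (auto simp: of_arity_zero length_eq_4)
qed

end

section \<open>Deformations over the dual numbers\<close>

lemma dual_ext_add: "dual_ext (\<phi> + \<chi>) = dual_ext \<phi> + dual_ext \<chi>"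
  by (simp add: fun_eq_iff dual_ext_def sum.distrib)

text \<open>Since t^2 = 0, lam + \<psi> is evaluated on the constant parts only.\<close>

lemma inf_deform_eq:
  "inf_deform \<delta> \<mu> lam \<psi> xs = dual_ext (\<delta> + \<mu>) xs + (0, (lam + \<psi>) (map fst xs))"
  by (simp add: inf_deform_def dual_ext_add mult_t_def) (simp add: dual_ext_def)

lemma of_arity_inf_deform:
  assumes "of_arity n (\<delta> + \<mu>)" "of_arity n (lam + \<psi>)"
  shows "of_arity n (inf_deform \<delta> \<mu> lam \<psi>)"
  using assms unfolding of_arity_def inf_deform_eq dual_ext_def by (simp add: zero_prod_def)

lemma inf_deform_arity2:
  "inf_deform \<delta> \<mu> lam \<psi> [x, y] = ((\<delta> + \<mu>) [fst x, fst y],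
     (\<delta> + \<mu>) [snd x, fst y] + (\<delta> + \<mu>) [fst x, snd y] + (lam + \<psi>) [fst x, fst y])"
  by (simp add: inf_deform_eq dual_ext_def lessThan_Suc add_ac)

lemma exp_t_eq: "exp_t \<beta> x = (fst x, snd x + \<beta> [fst x])"
  by (simp add: exp_t_def mult_t_def dual_ext_def prod_eq_iff)

text \<open>\<open>pullback\<close> is defined with \<open>inv\<close>, which injectivity allows to
  be cancelled.\<close>

lemma inj_exp_t: "inj (exp_t \<beta>)"
  unfolding inj_def exp_t_eq by (metis add_right_cancel prod.collapse prod.inject)

context parity_grading
begin

lemma parity_grading_dual: "parity_grading (dual_grade G)"
proof
  fix p x y and v :: "'v \<times> 'v"
  show "0 \<in> dual_grade G p"
    by (simp add: dual_grade_def zero_prod_def zero_mem)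
  show "x \<in> dual_grade G p \<Longrightarrow> y \<in> dual_grade G p \<Longrightarrow> x - y \<in> dual_grade G p"
    by (auto simp: dual_grade_def diff_mem)
  show "\<exists>a\<in>dual_grade G 0. \<exists>b\<in>dual_grade G 1. v = a + b"
    by (intro bexI[of _ "(component G 1 (fst v), component G 1 (snd v))"]
        bexI[of _ "(component G 0 (fst v), component G 0 (snd v))"])
       (simp_all add: prod_eq_iff dual_grade_def component_mem component_sum[symmetric])
  show "x \<in> dual_grade G 0 \<Longrightarrow> x \<in> dual_grade G 1 \<Longrightarrow> x = 0"
    using indep by (auto simp: dual_grade_def zero_prod_def)
  show "v + v = 0 \<Longrightarrow> v = 0"
    by (auto simp: prod_eq_iff intro: no_2_torsion)
qed

lemma koszul_dual: "koszul (dual_grade G) 1 x = (s (fst x), s (snd x))"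
proof -
  interpret dual: parity_grading "dual_grade G" by (rule parity_grading_dual)
  have "component (dual_grade G) p x = (component G p (fst x), component G p (snd x))" for p
    using dual.component_eq[of "(component G p (fst x), component G p (snd x))" p
        "(component G (p + 1) (fst x), component G (p + 1) (snd x))"]
    by (simp add: dual_grade_def component_mem component_sum' del: add_bit_eq_xor)
  then show ?thesis by (simp add: dual.koszul_1 koszul_1)
qed

lemma inf_deform_bracket_eq_zero_iff:
  assumes \<alpha>: "multi_additive (\<delta> + \<mu>)" "has_parity G 1 (\<delta> + \<mu>)" "of_arity 2 (\<delta> + \<mu>)"
    and \<phi>: "multi_additive (lam + \<psi>)" "has_parity G 1 (lam + \<psi>)" "of_arity 2 (lam + \<psi>)"
    and assoc: "bracket G (\<delta> + \<mu>) (\<delta> + \<mu>) = 0"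
  shows "bracket (dual_grade G) (inf_deform \<delta> \<mu> lam \<psi>) (inf_deform \<delta> \<mu> lam \<psi>) = 0 \<longleftrightarrow>
    bracket G (\<delta> + \<mu>) (lam + \<psi>) = 0"
proof -
  interpret dual: parity_grading "dual_grade G" by (rule parity_grading_dual)
  define a where "a = \<delta> + \<mu>"
  define f where "f = lam + \<psi>"
  define E where "E = inf_deform \<delta> \<mu> lam \<psi>"
  note A = \<alpha>[folded a_def] and F = \<phi>[folded f_def]
  have E: "E [x, y] = (a [fst x, fst y], a [snd x, fst y] + a [fst x, snd y] + f [fst x, fst y])" for x y
    by (simp only: E_def a_def f_def inf_deform_arity2)
  have E1: "of_arity 2 E"
    unfolding E_def using \<alpha>(3) \<phi>(3) by (rule of_arity_inf_deform)
  have E2: "multi_additive E"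
    by (rule multi_additive_arity2I[OF E1])
       (simp_all add: E multi_additive_args[OF A(1)] multi_additive_args[OF F(1)])
  have s_a: "s (a [x, y]) = - a [s x, s y]" and s_f: "s (f [x, y]) = - f [s x, s y]" for x y
    using has_parityD[OF A(1,2), of "[x, y]"] has_parityD[OF F(1,2), of "[x, y]"] by simp_all
  have E3: "has_parity (dual_grade G) 1 E"
    unfolding dual.has_parity_iff[OF E2]
  proof
    fix vs
    show "koszul (dual_grade G) 1 (E vs) = sign 1 (E (map (koszul (dual_grade G) 1) vs))"
    proof (cases "length vs = 2")
      case True
      then show ?thesis
        by (auto simp: length_eq_2 E koszul_dual s_a s_f koszul_add)
    next
      case False
      then show ?thesis using E1 dual.koszul_additive by (simp add: of_arity_def)
    qed
  qed
  have aa: "a [a [x, y], z] + a [s x, a [y, z]] = 0" for x y z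
    using bracket_self_eq_zero_iff[OF A] assoc by (simp add: a_def)
  \<comment> \<open>The product rule gives three associators of \<open>a\<close>, each with one
    argument replaced by its t-coefficient, and they vanish by \<open>aa\<close>. What remains is
    the bracket of \<open>a\<close> and \<open>f\<close>.\<close>
  have snd_eq: "snd (E [E [x, y], z] + E [koszul (dual_grade G) 1 x, E [y, z]])
      = bracket G a f [fst x, fst y, fst z]" for x y z
  proof -
    have "snd (E [E [x, y], z] + E [koszul (dual_grade G) 1 x, E [y, z]])
      = (a [a [snd x, fst y], fst z] + a [s (snd x), a [fst y, fst z]])
      + (a [a [fst x, snd y], fst z] + a [s (fst x), a [snd y, fst z]])
      + (a [a [fst x, fst y], snd z] + a [s (fst x), a [fst y, snd z]])
      + bracket G a f [fst x, fst y, fst z]"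
      by (simp add: E koszul_dual multi_additive_args[OF A(1)] bracket_arity2[OF A F] add_ac)
    then show ?thesis by (simp only: aa) simp
  qed
  have fst_eq: "fst (E [E [x, y], z] + E [koszul (dual_grade G) 1 x, E [y, z]]) = 0" for x y z
    by (simp add: E koszul_dual aa)
  have "bracket (dual_grade G) E E = 0 \<longleftrightarrow> (\<forall>(x :: 'v \<times> 'v) (y :: 'v \<times> 'v) (z :: 'v \<times> 'v). bracket G a f [fst x, fst y, fst z] = 0)"
    unfolding dual.bracket_self_eq_zero_iff[OF E2 E3 E1] prod_eq_iff snd_eq fst_eq by simp
  also have "\<dots> \<longleftrightarrow> (\<forall>x y z. bracket G a f [x, y, z] = 0)"
    by (metis fst_conv)
  also have "\<dots> \<longleftrightarrow> bracket G a f = 0"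
    using of_arity_eqI[of 3 "bracket G a f" 0] of_arity_bracket[OF A F]
    by (auto simp: of_arity_zero length_eq_3)
  finally show ?thesis by (simp add: E_def a_def f_def)
qed

lemma pullback_exp_t:
  assumes \<alpha>: "multi_additive (\<delta> + \<mu>)" "has_parity G 1 (\<delta> + \<mu>)" "of_arity 2 (\<delta> + \<mu>)"
    and \<beta>: "multi_additive \<beta>" "has_parity G 0 \<beta>" "of_arity 1 \<beta>"
    and \<phi>: "of_arity 2 (lam + \<psi>)" "of_arity 2 (lam' + \<psi>')"
    and eq: "lam' + \<psi>' = lam + \<psi> + bracket G (\<delta> + \<mu>) \<beta>"
  shows "pullback (exp_t \<beta>) (inf_deform \<delta> \<mu> lam \<psi>) = inf_deform \<delta> \<mu> lam' \<psi>'"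
proof
  fix xs
  \<comment> \<open>The claim with the inverse cleared: d \<circ> (f \<otimes> f) = f \<circ> d' for
    f = \<open>exp_t \<beta>\<close>.\<close>
  have "inf_deform \<delta> \<mu> lam \<psi> (map (exp_t \<beta>) xs) = exp_t \<beta> (inf_deform \<delta> \<mu> lam' \<psi>' xs)"
  proof (cases "length xs = 2")
    case True
    have "(lam' + \<psi>') [x, y] = (lam + \<psi>) [x, y] + ((\<delta> + \<mu>) [\<beta> [x], y] + (\<delta> + \<mu>) [x, \<beta> [y]]
        - \<beta> [(\<delta> + \<mu>) [x, y]])" for x y
      unfolding eq using bracket_arity1[OF \<alpha> \<beta>] by simp
    with True show ?thesis
      by (auto simp only: length_eq_2 list.map inf_deform_arity2 exp_t_eq fst_conv snd_conv
          multi_additive_args[OF \<alpha>(1)]) (simp add: algebra_simps)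
  next
    \<comment> \<open>Both deformations vanish outside arity 2, and \<open>exp_t \<beta>\<close>
      fixes 0.\<close>
    case False
    then show ?thesis
      using of_arity_inf_deform[OF \<alpha>(3) \<phi>(1)] of_arity_inf_deform[OF \<alpha>(3) \<phi>(2)]
        multi_additive_arg1(4)[OF \<beta>(1), of "[]"]
      by (simp add: of_arity_def exp_t_eq zero_prod_def)
  qed
  then show "pullback (exp_t \<beta>) (inf_deform \<delta> \<mu> lam \<psi>) xs = inf_deform \<delta> \<mu> lam' \<psi>' xs"
    by (simp add: pullback_def inv_f_f[OF inj_exp_t])
qed

end

lemma inf_deform_inject:
  fixes \<delta> :: "('v::ab_group_add) cochain"
  assumes "inf_deform \<delta> \<mu> lam \<psi> = inf_deform \<delta> \<mu> lam' \<psi>'"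
  shows "lam + \<psi> = lam' + \<psi>'"
proof
  fix vs :: "'v list"
  \<comment> \<open>Evaluating at arguments without t-part isolates lam + \<psi> in the coefficient
    of t.\<close>
  have "map fst (map (\<lambda>v. (v, 0 :: 'v)) vs) = vs" by (simp add: comp_def)
  then show "(lam + \<psi>) vs = (lam' + \<psi>') vs"
    using fun_cong[OF assms, of "map (\<lambda>v. (v, 0 :: 'v)) vs"] unfolding inf_deform_eq by simp
qed

section \<open>Cosets and induced bijections\<close>

lemma coset_eq_iff:
  fixes B :: "'a::ab_group_add set"
  assumes "0 \<in> B" "\<And>x y. x \<in> B \<Longrightarrow> y \<in> B \<Longrightarrow> x - y \<in> B"
  shows "a +o B = b +o B \<longleftrightarrow> a - b \<in> B"
proof
  assume "a +o B = b +o B"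
  moreover have "a \<in> a +o B" using set_plus_intro2[OF assms(1), of a] by simp
  ultimately show "a - b \<in> B" by (simp add: set_minus_plus)
next
  assume ab: "a - b \<in> B"
  have *: "x - b \<in> B \<longleftrightarrow> x - a \<in> B" for x
  proof
    assume "x - b \<in> B"
    then have "(x - b) - (a - b) \<in> B" using ab assms(2) by blast
    then show "x - a \<in> B" by simp
  next
    assume "x - a \<in> B"
    moreover have "0 - (a - b) \<in> B" using ab assms by blast
    ultimately have "(x - a) - (0 - (a - b)) \<in> B" using assms(2) by blast
    then show "x - b \<in> B" by (simp add: algebra_simps)
  qed
  then show "a +o B = b +o B"
    by (simp add: set_eq_iff set_minus_plus[symmetric])
qed

lemma coset_image_eq_iff:
  fixes f :: "'a::ab_group_add \<Rightarrow> 'b::ab_group_add"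
  assumes "\<And>x y. f (x + y) = f x + f y" "0 \<in> A" "\<And>x y. x \<in> A \<Longrightarrow> y \<in> A \<Longrightarrow> x - y \<in> A"
  shows "a +o f ` A = b +o f ` A \<longleftrightarrow> a - b \<in> f ` A"
proof (rule coset_eq_iff)
  note f = additiveD[of f, OF assms(1)]
  show "0 \<in> f ` A" using f(1) assms(2) by (metis image_eqI)
  show "x - y \<in> f ` A" if "x \<in> f ` A" "y \<in> f ` A" for x y
    using that assms(3) by (auto simp flip: f(3))
qed

text \<open>Two maps with the same fibres on a set of representatives: one direction makes the
  induced map well defined, the other makes it injective. It is applied with \<open>c\<close> the
  cohomology class and \<open>g\<close> the equivalence class of the extension.\<close>

lemma bij_betw_factor:
  assumes "\<And>x y. x \<in> R \<Longrightarrow> y \<in> R \<Longrightarrow> c x = c y \<longleftrightarrow> g x = g y"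
  shows "\<exists>F. bij_betw F (c ` R) (g ` R) \<and> (\<forall>x\<in>R. F (c x) = g x)"
proof (intro exI conjI)
  let ?F = "g \<circ> inv_into R c"
  have F: "?F (c x) = g x" if "x \<in> R" for x
    using assms[of "inv_into R c (c x)" x] that by (simp add: inv_into_into f_inv_into_f)
  then show "\<forall>x\<in>R. ?F (c x) = g x" by blast
  have "inj_on ?F (c ` R)"
    using F assms by (auto simp: inj_on_def)
  moreover have "?F ` c ` R = g ` R"
    using F by (simp add: image_image)
  ultimately show "bij_betw ?F (c ` R) (g ` R)" by (simp add: bij_betw_def)
qed

section \<open>Classification of infinitesimal extensions\<close>

locale extension = graded_pair scale M W
  for scale :: "'k::field \<Rightarrow> 'v::ab_group_add \<Rightarrow> 'v" and M W :: "bit \<Rightarrow> 'v set" +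
  fixes \<delta> \<mu> :: "'v cochain"
  assumes \<delta>: "\<delta> \<in> C_W scale M W 2" "assoc_structure (grade M W) \<delta>"
    and \<mu>: "\<mu> \<in> C_MW scale M W 2 0" "assoc_structure (grade M W) \<mu>"
begin

abbreviation C :: "nat \<Rightarrow> nat \<Rightarrow> 'v cochain set" where "C \<equiv> C_MW scale M W"

abbreviation D\<^sub>\<delta> :: "'v cochain \<Rightarrow> 'v cochain" where "D\<^sub>\<delta> \<equiv> bracket G \<delta>"

abbreviation D\<^sub>\<mu> :: "'v cochain \<Rightarrow> 'v cochain" where "D\<^sub>\<mu> \<equiv> bracket G \<mu>"

lemma C_eq: "C k l = Hom_T scale M W k l (part True)"
  by (simp add: C_MW_def part_def)

lemma \<delta>_Hom_T: "\<delta> \<in> Hom_T scale M W 0 2 (part False)"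
  using \<delta>(1) by (simp add: C_W_def part_def)

lemma \<mu>_Hom_T: "\<mu> \<in> Hom_T scale M W 2 0 (part True)"
  using \<mu>(1) by (simp add: C_eq)

lemma odd: "has_parity G 1 \<delta>" "has_parity G 1 \<mu>"
  and square_zero: "D\<^sub>\<delta> \<delta> = 0" "D\<^sub>\<mu> \<mu> = 0"
  using \<delta>(2) \<mu>(2) by (simp_all add: assoc_structure_def)

lemma multilinear: "multilinear scale \<delta>" "multilinear scale \<mu>"
  using \<delta>_Hom_T \<mu>_Hom_T by (simp_all add: Hom_T_iff)

lemmas additive = multilinear[THEN multilinear_additive]

lemma arity: "of_arity 2 \<delta>" "of_arity 2 \<mu>"
  using Hom_T_of_arity[OF \<delta>_Hom_T] Hom_T_of_arity[OF \<mu>_Hom_T]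
  by (simp_all only: add_0 add_0_right)

lemma C_multilinear: "\<phi> \<in> C k l \<Longrightarrow> multilinear scale \<phi>"
  by (simp add: C_eq Hom_T_iff)

lemma C_additive: "\<phi> \<in> C k l \<Longrightarrow> multi_additive \<phi>"
  by (intro multilinear_additive C_multilinear)

lemma C_of_arity: "\<phi> \<in> C k l \<Longrightarrow> of_arity (k + l) \<phi>"
  by (simp add: C_eq Hom_T_of_arity)

lemma C_closed:
  "0 \<in> C k l" "\<phi> \<in> C k l \<Longrightarrow> \<chi> \<in> C k l \<Longrightarrow> \<phi> + \<chi> \<in> C k l"
  "\<phi> \<in> C k l \<Longrightarrow> - \<phi> \<in> C k l" "\<phi> \<in> C k l \<Longrightarrow> \<chi> \<in> C k l \<Longrightarrow> \<phi> - \<chi> \<in> C k l"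
  "\<phi> \<in> C k l \<Longrightarrow> parity_part G q \<phi> \<in> C k l"
  using subspace_part[of True] unfolding C_eq
  by (auto intro: Hom_T_zero Hom_T_add Hom_T_minus Hom_T_diff parity_part_Hom_T)

lemmas D_add = bracket_add_right[OF multilinear(1)] bracket_add_right[OF multilinear(2)]

lemmas D_additive = bracket_additive[OF multilinear(1)] bracket_additive[OF multilinear(2)]

lemma bracket_C_homogeneous:
  assumes "multi_additive \<alpha>" "has_parity G 1 \<alpha>" "\<chi> \<in> C k l" "has_parity G q \<chi>"
    and "circ G q \<alpha> \<chi> \<in> C K L" "circ G 1 \<chi> \<alpha> \<in> C K L"
  shows "bracket G \<alpha> \<chi> \<in> C K L"
proof -
  have "bracket G \<alpha> \<chi> = circ G q \<alpha> \<chi> - (\<lambda>vs. sign q (circ G 1 \<chi> \<alpha> vs))"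
    using bracket_odd[OF assms(1,2) C_additive[OF assms(3)] assms(4)] by (simp add: fun_eq_iff)
  then show ?thesis
    using assms(5,6) Hom_T_sign[OF subspace_part] Hom_T_diff[OF subspace_part] by (simp add: C_eq)
qed

text \<open>As \<phi> need not be homogeneous, the bracket is computed on its parity parts. In
  \<open>D\<^sub>\<delta> \<phi>\<close> the term \<delta> \<circ> \<phi> vanishes, because \<phi>
  has values in M and \<delta> accepts only W.\<close>

lemma D_C:
  assumes "\<phi> \<in> C k l"
  shows "D\<^sub>\<delta> \<phi> \<in> C k (Suc l)" "D\<^sub>\<mu> \<phi> \<in> C (Suc k) l"
proof -
  let ?p = "\<lambda>q. parity_part G q \<phi>"
  have p: "?p q \<in> C k l" "has_parity G q (?p q)" for q
    using assms by (simp_all add: C_closed has_parity_part C_additive)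
  then have H: "?p q \<in> Hom_T scale M W k l (part True)" for q by (simp add: C_eq)
  have "circ G q \<delta> (?p q) \<in> C k (Suc l)" "circ G 1 (?p q) \<delta> \<in> C k (Suc l)"
    "circ G q \<mu> (?p q) \<in> C (Suc k) l" "circ G 1 (?p q) \<mu> \<in> C (Suc k) l" for q
    using circ_Hom_T_zero[OF \<delta>_Hom_T H[of q], of q] C_closed(1)
      circ_Hom_T[OF H[of q] \<delta>_Hom_T subspace_part, of k "Suc l"]
      circ_Hom_T[OF \<mu>_Hom_T H[of q] subspace_part, of "Suc k" l]
      circ_Hom_T[OF H[of q] \<mu>_Hom_T subspace_part, of "Suc k" l]
    by (simp_all add: C_eq)
  then have "D\<^sub>\<delta> (?p q) \<in> C k (Suc l)" "D\<^sub>\<mu> (?p q) \<in> C (Suc k) l" for q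
    using bracket_C_homogeneous[OF _ _ p(1,2)] additive odd by blast+
  then have "D\<^sub>\<delta> (?p 0) + D\<^sub>\<delta> (?p (0 + 1)) \<in> C k (Suc l)" "D\<^sub>\<mu> (?p 0) + D\<^sub>\<mu> (?p (0 + 1)) \<in> C (Suc k) l"
    by (intro C_closed(2); blast)+
  then show "D\<^sub>\<delta> \<phi> \<in> C k (Suc l)" "D\<^sub>\<mu> \<phi> \<in> C (Suc k) l"
    using parity_part_sum[OF C_additive[OF assms], of 0] by (simp_all flip: D_add)
qed

lemma D_C_11: "\<beta> \<in> C 0 1 \<Longrightarrow> D\<^sub>\<mu> \<beta> \<in> C 1 1" and D_C_02: "\<beta> \<in> C 0 1 \<Longrightarrow> D\<^sub>\<delta> \<beta> \<in> C 0 2"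
  using D_C[of \<beta> 0 1] by (simp_all add: numeral_2_eq_2)

lemma D_even_part:
  assumes "\<phi> \<in> C k l"
  shows "has_parity G 1 (D\<^sub>\<delta> \<phi>) \<Longrightarrow> D\<^sub>\<delta> (parity_part G 0 \<phi>) = D\<^sub>\<delta> \<phi>"
    "has_parity G 1 (D\<^sub>\<mu> \<phi>) \<Longrightarrow> D\<^sub>\<mu> (parity_part G 0 \<phi>) = D\<^sub>\<mu> \<phi>"
  using bracket_parity_part[OF multilinear(1) C_multilinear[OF assms] odd(1), of 0]
    bracket_parity_part[OF multilinear(2) C_multilinear[OF assms] odd(2), of 0]
  by simp_all

lemma D_odd_part:
  assumes "\<phi> \<in> C k l"
  shows "has_parity G 0 (D\<^sub>\<delta> \<phi>) \<Longrightarrow> D\<^sub>\<delta> (parity_part G 1 \<phi>) = D\<^sub>\<delta> \<phi>"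
    "has_parity G 0 (D\<^sub>\<mu> \<phi>) \<Longrightarrow> D\<^sub>\<mu> (parity_part G 1 \<phi>) = D\<^sub>\<mu> \<phi>"
  using bracket_parity_part[OF multilinear(1) C_multilinear[OF assms] odd(1), of 1]
    bracket_parity_part[OF multilinear(2) C_multilinear[OF assms] odd(2), of 1]
  by simp_all

lemma D_even_odd: "\<beta> \<in> C k l \<Longrightarrow> has_parity G 0 \<beta> \<Longrightarrow> has_parity G 1 (D\<^sub>\<delta> \<beta>) \<and> has_parity G 1 (D\<^sub>\<mu> \<beta>)"
  using has_parity_bracket[OF multilinear(1) C_multilinear odd(1)]
    has_parity_bracket[OF multilinear(2) C_multilinear odd(2)] by fastforce

text \<open>\<delta> + \<mu> is the product of the direct sum of the algebras M and W: the cross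
  terms vanish because neither product accepts a value of the other.\<close>

lemma \<delta>_\<mu>:
  "multilinear scale (\<delta> + \<mu>)" "has_parity G 1 (\<delta> + \<mu>)" "of_arity 2 (\<delta> + \<mu>)"
  "bracket G (\<delta> + \<mu>) (\<delta> + \<mu>) = 0"
proof -
  show ml: "multilinear scale (\<delta> + \<mu>)"
    using multilinear unfolding multilinear_def linear_iff by (simp add: scale_right_distrib algebra_simps)
  show "has_parity G 1 (\<delta> + \<mu>)" "of_arity 2 (\<delta> + \<mu>)"
    using odd arity has_parity_plus of_arity_plus by blast+
  have "circ G 1 \<delta> \<mu> = 0" "circ G 1 \<mu> \<delta> = 0"
    using circ_Hom_T_zero[OF \<delta>_Hom_T \<mu>_Hom_T] circ_Hom_T_zero[OF \<mu>_Hom_T \<delta>_Hom_T] by simp_all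
  then have "D\<^sub>\<delta> \<mu> = 0" "D\<^sub>\<mu> \<delta> = 0"
    by (simp_all add: fun_eq_iff bracket_odd[OF additive(1) odd(1) additive(2) odd(2)]
        bracket_odd[OF additive(2) odd(2) additive(1) odd(1)])
  then show "bracket G (\<delta> + \<mu>) (\<delta> + \<mu>) = 0"
    by (simp add: bracket_add_left[OF ml] D_add square_zero)
qed

text \<open>Polarizing \<open>D\<^sub>\<alpha>\<^sup>2 = 0\<close> at \<open>\<alpha> = \<delta> + \<mu>\<close>.\<close>

lemma D_anticommute:
  assumes "multilinear scale \<phi>" "bracket G (\<delta> + \<mu>) (bracket G (\<delta> + \<mu>) \<phi>) = 0"
    "D\<^sub>\<delta> (D\<^sub>\<delta> \<phi>) = 0" "D\<^sub>\<mu> (D\<^sub>\<mu> \<phi>) = 0"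
  shows "D\<^sub>\<mu> (D\<^sub>\<delta> \<phi>) = - D\<^sub>\<delta> (D\<^sub>\<mu> \<phi>)"
proof -
  note ml = multilinear_bracket[OF multilinear(1) assms(1)] multilinear_bracket[OF multilinear(2) assms(1)]
  have "bracket G (\<delta> + \<mu>) (bracket G (\<delta> + \<mu>) \<phi>) = D\<^sub>\<delta> (D\<^sub>\<mu> \<phi>) + D\<^sub>\<mu> (D\<^sub>\<delta> \<phi>)"
    unfolding bracket_add_left[OF assms(1)] bracket_add_right[OF \<delta>_\<mu>(1)]
      bracket_add_left[OF ml(1)] bracket_add_left[OF ml(2)] assms(3,4)
    by simp
  then show ?thesis using assms(2) by (simp add: eq_neg_iff_add_eq_0 add.commute)
qed

lemma D_squares_C01:
  assumes "\<beta> \<in> C 0 1" "has_parity G 0 \<beta>"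
  shows "D\<^sub>\<delta> (D\<^sub>\<delta> \<beta>) = 0" "D\<^sub>\<mu> (D\<^sub>\<mu> \<beta>) = 0" "D\<^sub>\<mu> (D\<^sub>\<delta> \<beta>) = - D\<^sub>\<delta> (D\<^sub>\<mu> \<beta>)"
proof -
  have "of_arity 1 \<beta>" using C_of_arity[OF assms(1)] by simp
  note B = C_multilinear[OF assms(1)] assms(2) this
  show *: "D\<^sub>\<delta> (D\<^sub>\<delta> \<beta>) = 0" "D\<^sub>\<mu> (D\<^sub>\<mu> \<beta>) = 0"
    using bracket_bracket_arity1[OF _ _ _ _ B] multilinear odd arity square_zero by simp_all
  show "D\<^sub>\<mu> (D\<^sub>\<delta> \<beta>) = - D\<^sub>\<delta> (D\<^sub>\<mu> \<beta>)"
    using bracket_bracket_arity1[OF \<delta>_\<mu> B] * by (rule D_anticommute[OF B(1)])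
qed

lemma D_squares_C11:
  assumes "lam \<in> C 1 1" "has_parity G 1 lam"
  shows "D\<^sub>\<delta> (D\<^sub>\<delta> lam) = 0" "D\<^sub>\<mu> (D\<^sub>\<mu> lam) = 0" "D\<^sub>\<mu> (D\<^sub>\<delta> lam) = - D\<^sub>\<delta> (D\<^sub>\<mu> lam)"
proof -
  have "of_arity 2 lam" using C_of_arity[OF assms(1)] by (simp add: numeral_2_eq_2)
  note B = C_multilinear[OF assms(1)] assms(2) this
  show *: "D\<^sub>\<delta> (D\<^sub>\<delta> lam) = 0" "D\<^sub>\<mu> (D\<^sub>\<mu> lam) = 0"
    using bracket_bracket_arity2[OF _ _ _ _ B] multilinear odd arity square_zero by simp_all
  show "D\<^sub>\<mu> (D\<^sub>\<delta> lam) = - D\<^sub>\<delta> (D\<^sub>\<mu> lam)"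
    using bracket_bracket_arity2[OF \<delta>_\<mu> B] * by (rule D_anticommute[OF B(1)])
qed

lemma C_sum_eq_zero:
  assumes "\<phi> \<in> C k l" "\<chi> \<in> C k' l'" "\<phi> + \<chi> = 0" "(k, l) \<noteq> (k', l')"
  shows "\<phi> = 0"
  using assms(2,4) by (intro Hom_T_sum_eq_zero[OF assms(1)[unfolded C_eq] assms(3)]) (auto simp: C_eq Hom_T_iff)

lemma C_sum_eq:
  assumes "\<phi> \<in> C k l" "\<phi>' \<in> C k l" "\<chi> \<in> C k' l'" "\<chi>' \<in> C k' l'"
    and "\<phi> + \<chi> = \<phi>' + \<chi>'" "(k, l) \<noteq> (k', l')"
  shows "\<phi> = \<phi>'" "\<chi> = \<chi>'"
proof -
  have "(\<phi> - \<phi>') + (\<chi> - \<chi>') = 0" using assms(5) by (simp add: algebra_simps)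
  then have "\<phi> - \<phi>' = 0"
    using C_sum_eq_zero[OF C_closed(4)[OF assms(1,2)] C_closed(4)[OF assms(3,4)]] assms(6) by blast
  then show "\<phi> = \<phi>'" by simp
  then show "\<chi> = \<chi>'" using assms(5) by simp
qed

section \<open>Extensions and equivalences as equations between cochains\<close>

lemma is_inf_ext_iff:
  "is_inf_ext scale M W \<delta> \<mu> lam \<psi> \<longleftrightarrow>
     lam \<in> C 1 1 \<and> has_parity G 1 lam \<and> \<psi> \<in> C 0 2 \<and> has_parity G 1 \<psi> \<and>
     D\<^sub>\<mu> lam = 0 \<and> D\<^sub>\<delta> lam + D\<^sub>\<mu> \<psi> = 0 \<and> D\<^sub>\<delta> \<psi> = 0"
proof (cases "lam \<in> C 1 1 \<and> has_parity G 1 lam \<and> \<psi> \<in> C 0 2 \<and> has_parity G 1 \<psi>")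
  case True
  then have lam: "lam \<in> C 1 1" "has_parity G 1 lam" and \<psi>: "\<psi> \<in> C 0 2" "has_parity G 1 \<psi>" by auto
  have "of_arity 2 (lam + \<psi>)"
    using C_of_arity[OF lam(1)] C_of_arity[OF \<psi>(1)] by (intro of_arity_plus) (simp_all add: numeral_2_eq_2)
  then have "is_inf_ext scale M W \<delta> \<mu> lam \<psi> \<longleftrightarrow> bracket G (\<delta> + \<mu>) (lam + \<psi>) = 0"
    unfolding is_inf_ext_def using lam \<psi> \<delta>_\<mu>
    by (subst inf_deform_bracket_eq_zero_iff)
       (simp_all add: multilinear_additive C_additive multi_additive_plus has_parity_plus)
  also have "bracket G (\<delta> + \<mu>) (lam + \<psi>) = D\<^sub>\<mu> lam + ((D\<^sub>\<delta> lam + D\<^sub>\<mu> \<psi>) + D\<^sub>\<delta> \<psi>)"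
    by (simp add: bracket_add_right[OF \<delta>_\<mu>(1)] bracket_add_left[OF C_multilinear[OF lam(1)]]
        bracket_add_left[OF C_multilinear[OF \<psi>(1)]] algebra_simps)
  also have "\<dots> = 0 \<longleftrightarrow> D\<^sub>\<mu> lam = 0 \<and> D\<^sub>\<delta> lam + D\<^sub>\<mu> \<psi> = 0 \<and> D\<^sub>\<delta> \<psi> = 0"
  proof
    assume sum: "D\<^sub>\<mu> lam + ((D\<^sub>\<delta> lam + D\<^sub>\<mu> \<psi>) + D\<^sub>\<delta> \<psi>) = 0"
    \<comment> \<open>The terms are grouped by bidegree: (2, 1), (1, 2) and (0, 3).\<close>
    have mem: "D\<^sub>\<mu> lam \<in> C 2 1" "D\<^sub>\<delta> lam + D\<^sub>\<mu> \<psi> \<in> C 1 2" "D\<^sub>\<delta> \<psi> \<in> C 0 3"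
      using D_C[OF lam(1)] D_C[OF \<psi>(1)] C_closed(2) by (simp_all add: eval_nat_numeral)
    have 1: "D\<^sub>\<mu> lam = 0"
      using mem by (intro Hom_T_sum_eq_zero[OF mem(1)[unfolded C_eq] sum]) (simp add: C_eq Hom_T_iff)
    then have 2: "(D\<^sub>\<delta> lam + D\<^sub>\<mu> \<psi>) + D\<^sub>\<delta> \<psi> = 0" using sum by simp
    then have "D\<^sub>\<delta> lam + D\<^sub>\<mu> \<psi> = 0" using C_sum_eq_zero[OF mem(2,3)] by simp
    then show "D\<^sub>\<mu> lam = 0 \<and> D\<^sub>\<delta> lam + D\<^sub>\<mu> \<psi> = 0 \<and> D\<^sub>\<delta> \<psi> = 0" using 1 2 by simp
  qed simp
  finally show ?thesis using True by blast
next
  case False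
  then show ?thesis unfolding is_inf_ext_def by blast
qed

lemma pullback_inf_deform:
  assumes "is_inf_ext scale M W \<delta> \<mu> lam \<psi>" "\<beta> \<in> C 0 1" "has_parity G 0 \<beta>"
  shows "pullback (exp_t \<beta>) (inf_deform \<delta> \<mu> lam \<psi>) = inf_deform \<delta> \<mu> (lam + D\<^sub>\<mu> \<beta>) (\<psi> + D\<^sub>\<delta> \<beta>)"
proof -
  have ext: "lam \<in> C 1 1" "\<psi> \<in> C 0 2" using assms(1) by (simp_all add: is_inf_ext_iff)
  have C2: "of_arity 2 \<phi>" if "\<phi> \<in> C 1 1 \<or> \<phi> \<in> C 0 2" for \<phi>
    using that C_of_arity[of \<phi> 1 1] C_of_arity[of \<phi> 0 2] by (auto simp: numeral_2_eq_2)
  show ?thesis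
  proof (rule pullback_exp_t)
    show "of_arity 2 (lam + \<psi>)" "of_arity 2 (lam + D\<^sub>\<mu> \<beta> + (\<psi> + D\<^sub>\<delta> \<beta>))"
      using C2 ext D_C_11[OF assms(2)] D_C_02[OF assms(2)] by (auto intro!: of_arity_plus)
    show "lam + D\<^sub>\<mu> \<beta> + (\<psi> + D\<^sub>\<delta> \<beta>) = lam + \<psi> + bracket G (\<delta> + \<mu>) \<beta>"
      by (simp add: bracket_add_left[OF C_multilinear[OF assms(2)]] algebra_simps)
    show "of_arity 1 \<beta>" using C_of_arity[OF assms(2)] by simp
  qed (use \<delta>_\<mu> assms C_additive multilinear_additive in blast)+
qed

text \<open>A deformation determines only the sum lam + \<psi>; the two summands are recovered from
  it because their bidegrees (1, 1) and (0, 2) differ.\<close>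

lemma inf_equiv_iff:
  assumes "is_inf_ext scale M W \<delta> \<mu> lam \<psi>" "is_inf_ext scale M W \<delta> \<mu> lam' \<psi>'"
  shows "(inf_deform \<delta> \<mu> lam \<psi>, inf_deform \<delta> \<mu> lam' \<psi>') \<in> inf_equiv scale M W \<delta> \<mu> \<longleftrightarrow>
    (\<exists>\<beta>\<in>C 0 1. has_parity G 0 \<beta> \<and> lam' = lam + D\<^sub>\<mu> \<beta> \<and> \<psi>' = \<psi> + D\<^sub>\<delta> \<beta>)"
proof -
  have "inf_deform \<delta> \<mu> lam' \<psi>' = pullback (exp_t \<beta>) (inf_deform \<delta> \<mu> lam \<psi>) \<longleftrightarrow>
      lam' = lam + D\<^sub>\<mu> \<beta> \<and> \<psi>' = \<psi> + D\<^sub>\<delta> \<beta>" if \<beta>: "\<beta> \<in> C 0 1" "has_parity G 0 \<beta>" for \<beta>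
  proof -
    have "lam' = lam + D\<^sub>\<mu> \<beta> \<and> \<psi>' = \<psi> + D\<^sub>\<delta> \<beta>"
      if "inf_deform \<delta> \<mu> lam' \<psi>' = inf_deform \<delta> \<mu> (lam + D\<^sub>\<mu> \<beta>) (\<psi> + D\<^sub>\<delta> \<beta>)"
      using inf_deform_inject[OF that] assms D_C_11[OF \<beta>(1)] D_C_02[OF \<beta>(1)] C_closed(2)
        C_sum_eq[of lam' 1 1 "lam + D\<^sub>\<mu> \<beta>" \<psi>' 0 2 "\<psi> + D\<^sub>\<delta> \<beta>"] by (simp add: is_inf_ext_iff)
    then show ?thesis using pullback_inf_deform[OF assms(1) \<beta>] by auto
  qed
  then show ?thesis using assms unfolding inf_equiv_def inf_exts_def by auto
qed

lemma inf_equiv_cases: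
  assumes "(d, d') \<in> inf_equiv scale M W \<delta> \<mu>"
  obtains lam \<psi> lam' \<psi>' where "d = inf_deform \<delta> \<mu> lam \<psi>" "d' = inf_deform \<delta> \<mu> lam' \<psi>'"
    "is_inf_ext scale M W \<delta> \<mu> lam \<psi>" "is_inf_ext scale M W \<delta> \<mu> lam' \<psi>'"
  using assms unfolding inf_equiv_def inf_exts_def by auto

text \<open>Equivalence is translation by the group of even \<beta>; the witnesses are 0, -\<beta>
  and \<beta> + \<gamma>.\<close>

lemma equiv_inf_equiv: "equiv (inf_exts scale M W \<delta> \<mu>) (inf_equiv scale M W \<delta> \<mu>)"
proof (rule equivI)
  show "inf_equiv scale M W \<delta> \<mu> \<subseteq> inf_exts scale M W \<delta> \<mu> \<times> inf_exts scale M W \<delta> \<mu>"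
    by (auto simp: inf_equiv_def)
  show "refl_on (inf_exts scale M W \<delta> \<mu>) (inf_equiv scale M W \<delta> \<mu>)"
    using C_closed(1)[of 0 1] has_parity_zero[of 0]
    by (auto simp: refl_on_def inf_exts_def inf_equiv_iff D_additive intro!: bexI[of _ 0])
  show "sym (inf_equiv scale M W \<delta> \<mu>)"
  proof (rule symI)
    fix d d' assume dd: "(d, d') \<in> inf_equiv scale M W \<delta> \<mu>"
    then show "(d', d) \<in> inf_equiv scale M W \<delta> \<mu>"
    proof (cases rule: inf_equiv_cases)
      case (1 lam \<psi> lam' \<psi>')
      then obtain \<beta> where "\<beta> \<in> C 0 1" "has_parity G 0 \<beta>" "lam' = lam + D\<^sub>\<mu> \<beta>" "\<psi>' = \<psi> + D\<^sub>\<delta> \<beta>"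
        using dd inf_equiv_iff by auto
      then show ?thesis
        using 1 has_parity_minus[OF has_parity_zero, of 0 \<beta>]
        by (auto simp: inf_equiv_iff D_additive C_closed intro!: bexI[of _ "- \<beta>"])
    qed
  qed
  show "trans (inf_equiv scale M W \<delta> \<mu>)"
  proof (rule transI)
    fix d d' d'' assume dd: "(d, d') \<in> inf_equiv scale M W \<delta> \<mu>" "(d', d'') \<in> inf_equiv scale M W \<delta> \<mu>"
    obtain lam \<psi> lam' \<psi>' where 1: "d = inf_deform \<delta> \<mu> lam \<psi>" "d' = inf_deform \<delta> \<mu> lam' \<psi>'"
      "is_inf_ext scale M W \<delta> \<mu> lam \<psi>" "is_inf_ext scale M W \<delta> \<mu> lam' \<psi>'"
      using dd(1) by (rule inf_equiv_cases)
    obtain lam'' \<psi>'' where 2: "d'' = inf_deform \<delta> \<mu> lam'' \<psi>''"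
      "is_inf_ext scale M W \<delta> \<mu> lam'' \<psi>''"
      using dd(2) by (rule inf_equiv_cases)
    obtain \<beta> where "\<beta> \<in> C 0 1" "has_parity G 0 \<beta>" "lam' = lam + D\<^sub>\<mu> \<beta>" "\<psi>' = \<psi> + D\<^sub>\<delta> \<beta>"
      using dd(1) 1 inf_equiv_iff by auto
    moreover obtain \<gamma> where "\<gamma> \<in> C 0 1" "has_parity G 0 \<gamma>" "lam'' = lam' + D\<^sub>\<mu> \<gamma>" "\<psi>'' = \<psi>' + D\<^sub>\<delta> \<gamma>"
      using dd(2) 1 2 inf_equiv_iff by auto
    ultimately have "\<beta> + \<gamma> \<in> C 0 1" "has_parity G 0 (\<beta> + \<gamma>)"
      "lam'' = lam + D\<^sub>\<mu> (\<beta> + \<gamma>)" "\<psi>'' = \<psi> + D\<^sub>\<delta> (\<beta> + \<gamma>)"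
      by (simp_all add: C_closed has_parity_plus D_add add.assoc)
    then show "(d, d'') \<in> inf_equiv scale M W \<delta> \<mu>"
      using 1 2 inf_equiv_iff by auto
  qed
qed

section \<open>Cohomology classes and the obstruction\<close>

lemma H11_class_eq_iff:
  assumes "lam \<in> C 1 1" "has_parity G 1 lam" "lam' \<in> C 1 1" "has_parity G 1 lam'"
  shows "H_mu_class scale M W \<mu> 1 1 lam = H_mu_class scale M W \<mu> 1 1 lam' \<longleftrightarrow>
    (\<exists>\<beta>\<in>C 0 1. has_parity G 0 \<beta> \<and> lam' = lam + D\<^sub>\<mu> \<beta>)"
proof -
  have B: "B_mu scale M W \<mu> 1 1 = D\<^sub>\<mu> ` C 0 1" by (simp add: B_mu_def)
  have eq: "H_mu_class scale M W \<mu> 1 1 lam' = H_mu_class scale M W \<mu> 1 1 lam \<longleftrightarrow>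
      lam' - lam \<in> D\<^sub>\<mu> ` C 0 1"
    unfolding H_mu_class_def B by (intro coset_image_eq_iff D_add C_closed)
  have "lam' - lam \<in> D\<^sub>\<mu> ` C 0 1 \<longleftrightarrow> (\<exists>\<beta>\<in>C 0 1. has_parity G 0 \<beta> \<and> lam' - lam = D\<^sub>\<mu> \<beta>)"
  proof
    assume "lam' - lam \<in> D\<^sub>\<mu> ` C 0 1"
    then obtain \<beta> where \<beta>: "\<beta> \<in> C 0 1" "lam' - lam = D\<^sub>\<mu> \<beta>" by blast
    \<comment> \<open>A difference of odd cocycles is odd, so an arbitrary primitive \<beta> may be
      replaced by its even part.\<close>
    then have "has_parity G 1 (D\<^sub>\<mu> \<beta>)" using has_parity_minus[OF assms(4,2)] by simp
    then have "lam' - lam = D\<^sub>\<mu> (parity_part G 0 \<beta>)" using \<beta> D_even_part by simp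
    then show "\<exists>\<beta>\<in>C 0 1. has_parity G 0 \<beta> \<and> lam' - lam = D\<^sub>\<mu> \<beta>"
      using \<beta>(1) C_closed(5) has_parity_part[OF C_additive] by blast
  qed blast
  also have "\<dots> \<longleftrightarrow> (\<exists>\<beta>\<in>C 0 1. has_parity G 0 \<beta> \<and> lam' = lam + D\<^sub>\<mu> \<beta>)"
    by (simp only: diff_eq_eq add.commute[of _ lam])
  finally show ?thesis using eq by auto
qed

lemma H12_class_eq_zero_iff:
  "H12_ker_class scale M W \<delta> \<mu> \<phi> = H12_ker_class scale M W \<delta> \<mu> 0 \<longleftrightarrow>
    (\<exists>\<psi>\<in>C 0 2. D\<^sub>\<delta> \<psi> = 0 \<and> \<phi> = D\<^sub>\<mu> \<psi>)"
proof -
  have "H12_ker_class scale M W \<delta> \<mu> \<phi> = H12_ker_class scale M W \<delta> \<mu> 0 \<longleftrightarrow>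
      \<phi> - 0 \<in> D\<^sub>\<mu> ` {\<psi> \<in> C 0 2. D\<^sub>\<delta> \<psi> = 0}"
    unfolding H12_ker_class_def B12_ker_def
    by (rule coset_image_eq_iff) (simp_all add: D_add D_additive C_closed)
  then show ?thesis by auto
qed

lemma obstruction_iff:
  assumes "lam \<in> odd_Z_mu scale M W \<mu> 1 1"
  shows "H12_ker_class scale M W \<delta> \<mu> (D\<^sub>\<delta> lam) = H12_ker_class scale M W \<delta> \<mu> 0 \<longleftrightarrow>
    (\<exists>\<psi>. is_inf_ext scale M W \<delta> \<mu> lam \<psi>)"
proof -
  have lam: "lam \<in> C 1 1" "has_parity G 1 lam" "D\<^sub>\<mu> lam = 0"
    using assms by (simp_all add: odd_Z_mu_def Z_mu_def)
  show ?thesis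
    unfolding H12_class_eq_zero_iff
  proof
    assume "\<exists>\<psi>\<in>C 0 2. D\<^sub>\<delta> \<psi> = 0 \<and> D\<^sub>\<delta> lam = D\<^sub>\<mu> \<psi>"
    then obtain \<psi> where \<psi>: "\<psi> \<in> C 0 2" "D\<^sub>\<delta> \<psi> = 0" "D\<^sub>\<delta> lam = D\<^sub>\<mu> \<psi>" by blast
    let ?\<psi> = "parity_part G 1 \<psi>"
    have "has_parity G 0 (D\<^sub>\<mu> \<psi>)"
      using has_parity_bracket[OF multilinear(1) C_multilinear[OF lam(1)] odd(1) lam(2)] \<psi>(3) by simp
    \<comment> \<open>The odd part of \<psi> serves both equations at once:
      \<open>D\<^sub>\<delta> \<psi>\<close> is zero and therefore counts as even.\<close>
    then have "D\<^sub>\<mu> ?\<psi> = D\<^sub>\<delta> lam" "D\<^sub>\<delta> ?\<psi> = 0"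
      using D_odd_part[OF \<psi>(1)] \<psi> has_parity_zero by simp_all
    moreover have "?\<psi> \<in> C 0 2" "has_parity G 1 ?\<psi>"
      using \<psi>(1) by (simp_all add: C_closed has_parity_part C_additive)
    \<comment> \<open>The sign turns \<open>D\<^sub>\<delta> lam = D\<^sub>\<mu> \<psi>\<close> into
      the sum condition of an extension.\<close>
    ultimately have "is_inf_ext scale M W \<delta> \<mu> lam (- ?\<psi>)"
      using lam has_parity_minus[OF has_parity_zero, of 1 ?\<psi>]
      by (simp add: is_inf_ext_iff C_closed D_additive)
    then show "\<exists>\<psi>. is_inf_ext scale M W \<delta> \<mu> lam \<psi>" by blast
  next
    assume "\<exists>\<psi>. is_inf_ext scale M W \<delta> \<mu> lam \<psi>"
    then obtain \<psi> where "\<psi> \<in> C 0 2" "D\<^sub>\<delta> lam + D\<^sub>\<mu> \<psi> = 0" "D\<^sub>\<delta> \<psi> = 0"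
      by (auto simp: is_inf_ext_iff)
    then show "\<exists>\<psi>\<in>C 0 2. D\<^sub>\<delta> \<psi> = 0 \<and> D\<^sub>\<delta> lam = D\<^sub>\<mu> \<psi>"
      by (intro bexI[of _ "- \<psi>"]) (simp_all add: D_additive C_closed eq_neg_iff_add_eq_0)
  qed
qed

lemma is_inf_ext_odd_Z: "is_inf_ext scale M W \<delta> \<mu> lam \<psi> \<Longrightarrow> lam \<in> odd_Z_mu scale M W \<mu> 1 1"
  by (simp add: is_inf_ext_iff odd_Z_mu_def Z_mu_def)

text \<open>The new mixed terms are \<open>D\<^sub>\<delta> (D\<^sub>\<mu> \<beta>)\<close> and
  \<open>D\<^sub>\<mu> (D\<^sub>\<delta> \<beta>)\<close>, which cancel by anticommutation.\<close>

lemma is_inf_ext_shift: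
  assumes "is_inf_ext scale M W \<delta> \<mu> lam \<psi>" "\<beta> \<in> C 0 1" "has_parity G 0 \<beta>"
  shows "is_inf_ext scale M W \<delta> \<mu> (lam + D\<^sub>\<mu> \<beta>) (\<psi> + D\<^sub>\<delta> \<beta>)"
proof -
  have "D\<^sub>\<delta> (lam + D\<^sub>\<mu> \<beta>) + D\<^sub>\<mu> (\<psi> + D\<^sub>\<delta> \<beta>) = D\<^sub>\<delta> lam + D\<^sub>\<mu> \<psi>"
    by (simp add: D_add D_squares_C01[OF assms(2,3)])
  then show ?thesis
    using assms D_squares_C01[OF assms(2,3)] D_C_11[OF assms(2)] D_C_02[OF assms(2)]
      D_even_odd[OF assms(2,3)]
    by (simp add: is_inf_ext_iff C_closed has_parity_plus D_add)
qed

section \<open>The classes in H^{0,2}\<close>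

lemma H0_class: "H_mu_class scale M W \<mu> 0 l \<tau> = {\<tau>}"
  by (simp add: H_mu_class_def B_mu_def elt_set_plus_def)

lemma odd_reps02_iff:
  "\<tau> \<in> odd_reps02 scale M W \<delta> \<mu> \<longleftrightarrow> \<tau> \<in> C 0 2 \<and> has_parity G 1 \<tau> \<and> D\<^sub>\<mu> \<tau> = 0 \<and> D\<^sub>\<delta> \<tau> = 0"
proof -
  have "{\<tau>} \<in> H_mu scale M W \<mu> 0 2" if "\<tau> \<in> Z_mu scale M W \<mu> 0 2"
    using that by (auto simp: H_mu_def quot_def B_mu_def elt_set_plus_def)
  then show ?thesis
    by (auto simp: odd_reps02_def odd_Z_mu_def Z02_bar_def D_bar_def H0_class Z_mu_def)
qed

text \<open>Behind the singletons this is an ordinary coset: H^{0,1} consists of the \<mu>-cocycles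
  themselves, so the denominator is the image under \<open>D\<^sub>\<delta>\<close> of those
  cocycles.\<close>

lemma H02_class_eq:
  "H02_class scale M W \<delta> \<mu> \<tau> = (\<lambda>\<phi>. {\<phi>}) ` (\<tau> +o D\<^sub>\<delta> ` {\<beta> \<in> C 0 1. D\<^sub>\<mu> \<beta> = 0})"
proof -
  have "H_mu scale M W \<mu> 0 1 = (\<lambda>\<beta>. {\<beta>}) ` {\<beta> \<in> C 0 1. D\<^sub>\<mu> \<beta> = 0}"
    by (simp add: H_mu_def quot_def B_mu_def elt_set_plus_def Z_mu_def)
  then have "B02_bar scale M W \<delta> \<mu> = (\<lambda>\<phi>. {\<phi>}) ` D\<^sub>\<delta> ` {\<beta> \<in> C 0 1. D\<^sub>\<mu> \<beta> = 0}"
    by (simp add: B02_bar_def image_image D_bar_def H0_class)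
  then show ?thesis
    unfolding H02_class_def H0_class elt_set_plus_def set_plus_def by auto
qed

lemma H02_class_eq_iff:
  assumes "has_parity G 1 \<tau>" "has_parity G 1 \<tau>'"
  shows "H02_class scale M W \<delta> \<mu> \<tau> = H02_class scale M W \<delta> \<mu> \<tau>' \<longleftrightarrow>
    (\<exists>\<beta>\<in>C 0 1. has_parity G 0 \<beta> \<and> D\<^sub>\<mu> \<beta> = 0 \<and> \<tau>' = \<tau> + D\<^sub>\<delta> \<beta>)"
proof -
  let ?B = "D\<^sub>\<delta> ` {\<beta> \<in> C 0 1. D\<^sub>\<mu> \<beta> = 0}"
  have "\<tau>' +o ?B = \<tau> +o ?B \<longleftrightarrow> \<tau>' - \<tau> \<in> ?B"
    by (rule coset_image_eq_iff) (simp_all add: D_add D_additive C_closed)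
  moreover have "H02_class scale M W \<delta> \<mu> \<tau> = H02_class scale M W \<delta> \<mu> \<tau>' \<longleftrightarrow> \<tau>' +o ?B = \<tau> +o ?B"
    unfolding H02_class_eq by (subst inj_image_eq_iff) (auto simp: inj_def)
  moreover have "\<tau>' - \<tau> \<in> ?B \<longleftrightarrow> (\<exists>\<beta>\<in>C 0 1. has_parity G 0 \<beta> \<and> D\<^sub>\<mu> \<beta> = 0 \<and> \<tau>' - \<tau> = D\<^sub>\<delta> \<beta>)"
  proof
    assume "\<tau>' - \<tau> \<in> ?B"
    then obtain \<beta> where \<beta>: "\<beta> \<in> C 0 1" "D\<^sub>\<mu> \<beta> = 0" "\<tau>' - \<tau> = D\<^sub>\<delta> \<beta>" by blast
    \<comment> \<open>\<open>D\<^sub>\<mu> \<beta>\<close> is zero and hence odd as well, so the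
      same even part of \<beta> satisfies both equations.\<close>
    have "has_parity G 1 (D\<^sub>\<delta> \<beta>)" "has_parity G 1 (D\<^sub>\<mu> \<beta>)"
      using \<beta> has_parity_minus[OF assms(2,1)] has_parity_zero by simp_all
    then have "D\<^sub>\<mu> (parity_part G 0 \<beta>) = 0" "\<tau>' - \<tau> = D\<^sub>\<delta> (parity_part G 0 \<beta>)"
      using D_even_part[OF \<beta>(1)] \<beta> by simp_all
    then show "\<exists>\<beta>\<in>C 0 1. has_parity G 0 \<beta> \<and> D\<^sub>\<mu> \<beta> = 0 \<and> \<tau>' - \<tau> = D\<^sub>\<delta> \<beta>"
      using C_closed(5)[OF \<beta>(1)] has_parity_part[OF C_additive[OF \<beta>(1)]] by blast
  qed blast
  ultimately show ?thesis
    by (simp only: diff_eq_eq add.commute[of _ \<tau>])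
qed

lemma is_inf_ext_add_reps:
  assumes "is_inf_ext scale M W \<delta> \<mu> lam \<psi>" "\<tau> \<in> odd_reps02 scale M W \<delta> \<mu>"
  shows "is_inf_ext scale M W \<delta> \<mu> lam (\<psi> + \<tau>)"
  using assms by (simp add: is_inf_ext_iff odd_reps02_iff C_closed has_parity_plus D_add)

section \<open>Equivalence classes of extensions over a fixed class in H^{1,1}\<close>

lemma equiv_class_eq_iff_inf:
  assumes "is_inf_ext scale M W \<delta> \<mu> lam \<psi>" "is_inf_ext scale M W \<delta> \<mu> lam' \<psi>'"
  shows "inf_equiv scale M W \<delta> \<mu> `` {inf_deform \<delta> \<mu> lam \<psi>} = inf_equiv scale M W \<delta> \<mu> `` {inf_deform \<delta> \<mu> lam' \<psi>'}
    \<longleftrightarrow> (\<exists>\<beta>\<in>C 0 1. has_parity G 0 \<beta> \<and> lam' = lam + D\<^sub>\<mu> \<beta> \<and> \<psi>' = \<psi> + D\<^sub>\<delta> \<beta>)"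
proof -
  have "inf_deform \<delta> \<mu> lam \<psi> \<in> inf_exts scale M W \<delta> \<mu>" "inf_deform \<delta> \<mu> lam' \<psi>' \<in> inf_exts scale M W \<delta> \<mu>"
    using assms unfolding inf_exts_def by blast+
  then show ?thesis
    using eq_equiv_class_iff[OF equiv_inf_equiv] inf_equiv_iff[OF assms] by simp
qed

text \<open>An equivalence that keeps \<open>lam\<close> fixed has
  \<open>D\<^sub>\<mu> \<beta> = 0\<close> and shifts \<psi> by
  \<open>D\<^sub>\<delta> \<beta>\<close>: these shifts are exactly the even-primitive coboundaries
  in H^{0,2}.\<close>

lemma H02_class_eq_iff_equiv:
  assumes "is_inf_ext scale M W \<delta> \<mu> lam \<psi>"
    and "\<tau> \<in> odd_reps02 scale M W \<delta> \<mu>" "\<tau>' \<in> odd_reps02 scale M W \<delta> \<mu>"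
  shows "H02_class scale M W \<delta> \<mu> \<tau> = H02_class scale M W \<delta> \<mu> \<tau>' \<longleftrightarrow>
    inf_equiv scale M W \<delta> \<mu> `` {inf_deform \<delta> \<mu> lam (\<psi> + \<tau>)} =
    inf_equiv scale M W \<delta> \<mu> `` {inf_deform \<delta> \<mu> lam (\<psi> + \<tau>')}"
proof -
  have odd: "has_parity G 1 \<tau>" "has_parity G 1 \<tau>'" using assms by (simp_all add: odd_reps02_iff)
  show ?thesis
    unfolding equiv_class_eq_iff_inf[OF is_inf_ext_add_reps[OF assms(1,2)] is_inf_ext_add_reps[OF assms(1,3)]]
      H02_class_eq_iff[OF odd]
    by (simp add: add.assoc)
qed

text \<open>Surjectivity of the parametrization: every extension with the given class can be moved
  to one with \<open>lam\<close> itself.\<close>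

lemma inf_ext_classes:
  assumes "is_inf_ext scale M W \<delta> \<mu> lam \<psi>"
  shows "{inf_equiv scale M W \<delta> \<mu> `` {inf_deform \<delta> \<mu> lam' \<psi>'} | lam' \<psi>'.
       is_inf_ext scale M W \<delta> \<mu> lam' \<psi>' \<and>
       H_mu_class scale M W \<mu> 1 1 lam' = H_mu_class scale M W \<mu> 1 1 lam} =
    (\<lambda>\<tau>. inf_equiv scale M W \<delta> \<mu> `` {inf_deform \<delta> \<mu> lam (\<psi> + \<tau>)}) ` odd_reps02 scale M W \<delta> \<mu>"
    (is "?L = ?R")
proof
  show "?R \<subseteq> ?L"
    using is_inf_ext_add_reps[OF assms] by blast
  show "?L \<subseteq> ?R"
  proof
    fix X assume "X \<in> ?L"
    then obtain lam' \<psi>' where X: "X = inf_equiv scale M W \<delta> \<mu> `` {inf_deform \<delta> \<mu> lam' \<psi>'}"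
      "is_inf_ext scale M W \<delta> \<mu> lam' \<psi>'"
      "H_mu_class scale M W \<mu> 1 1 lam' = H_mu_class scale M W \<mu> 1 1 lam" by blast
    \<comment> \<open>\<beta> is oriented from \<open>lam'\<close> to \<open>lam\<close>, so that
      shifting by it yields an extension over \<open>lam\<close>.\<close>
    then obtain \<beta> where \<beta>: "\<beta> \<in> C 0 1" "has_parity G 0 \<beta>" "lam = lam' + D\<^sub>\<mu> \<beta>"
      using H11_class_eq_iff[of lam' lam] assms by (auto simp: is_inf_ext_iff)
    \<comment> \<open>Two solutions over the same \<open>lam\<close> differ by a cochain killed by
      both differentials.\<close>
    define \<tau> where "\<tau> = \<psi>' + D\<^sub>\<delta> \<beta> - \<psi>"
    have ext: "is_inf_ext scale M W \<delta> \<mu> lam (\<psi>' + D\<^sub>\<delta> \<beta>)"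
      using is_inf_ext_shift[OF X(2) \<beta>(1,2)] \<beta>(3) by simp
    have "D\<^sub>\<delta> lam + D\<^sub>\<mu> (\<psi>' + D\<^sub>\<delta> \<beta>) = 0" "D\<^sub>\<delta> lam + D\<^sub>\<mu> \<psi> = 0"
      using ext assms by (simp_all add: is_inf_ext_iff)
    then have "D\<^sub>\<mu> (\<psi>' + D\<^sub>\<delta> \<beta>) = D\<^sub>\<mu> \<psi>" by (metis add_left_cancel)
    then have "\<tau> \<in> odd_reps02 scale M W \<delta> \<mu>"
      using ext assms unfolding \<tau>_def odd_reps02_iff is_inf_ext_iff
      by (simp add: C_closed has_parity_minus D_additive)
    moreover have "X = inf_equiv scale M W \<delta> \<mu> `` {inf_deform \<delta> \<mu> lam (\<psi> + \<tau>)}"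
      unfolding X(1) \<tau>_def using equiv_class_eq_iff_inf[OF X(2) ext] \<beta> by auto
    ultimately show "X \<in> ?R" by blast
  qed
qed

lemma inf_equiv_H11_class:
  assumes "is_inf_ext scale M W \<delta> \<mu> lam \<psi>" "is_inf_ext scale M W \<delta> \<mu> lam' \<psi>'"
    and "(inf_deform \<delta> \<mu> lam \<psi>, inf_deform \<delta> \<mu> lam' \<psi>') \<in> inf_equiv scale M W \<delta> \<mu>"
  shows "H_mu_class scale M W \<mu> 1 1 lam = H_mu_class scale M W \<mu> 1 1 lam'"
  using assms(3) assms(1,2) unfolding inf_equiv_iff[OF assms(1,2)] is_inf_ext_iff
  by (subst H11_class_eq_iff) auto

text \<open>By anticommutation and \<open>D\<^sub>\<mu> lam = 0\<close>; this is what gives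
  \<open>D\<^sub>\<delta> lam\<close> a class in the restricted cohomology.\<close>

lemma D_\<delta>_odd_Z:
  assumes "lam \<in> odd_Z_mu scale M W \<mu> 1 1"
  shows "D\<^sub>\<delta> lam \<in> Z12_ker scale M W \<delta> \<mu>"
  using assms D_squares_C11[of lam] D_C(1)[of lam 1 1]
  by (simp add: odd_Z_mu_def Z_mu_def Z12_ker_def D_additive numeral_2_eq_2)

text \<open>The obstruction vanishes exactly when an extension exists, and an extension over
  \<open>lam\<close> can be shifted to one over \<open>lam'\<close>.\<close>

lemma obstruction_class:
  assumes "lam \<in> odd_Z_mu scale M W \<mu> 1 1" "lam' \<in> odd_Z_mu scale M W \<mu> 1 1"
    and "H_mu_class scale M W \<mu> 1 1 lam = H_mu_class scale M W \<mu> 1 1 lam'"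
    and "H12_ker_class scale M W \<delta> \<mu> (D\<^sub>\<delta> lam) = H12_ker_class scale M W \<delta> \<mu> 0"
  shows "H12_ker_class scale M W \<delta> \<mu> (D\<^sub>\<delta> lam') = H12_ker_class scale M W \<delta> \<mu> 0"
proof -
  obtain \<psi> where "is_inf_ext scale M W \<delta> \<mu> lam \<psi>" using assms(1,4) obstruction_iff by blast
  moreover obtain \<beta> where "\<beta> \<in> C 0 1" "has_parity G 0 \<beta>" "lam' = lam + D\<^sub>\<mu> \<beta>"
    using assms(1-3) H11_class_eq_iff[of lam lam'] by (auto simp: odd_Z_mu_def Z_mu_def)
  ultimately show ?thesis using is_inf_ext_shift obstruction_iff[OF assms(2)] by blast
qed

end

theorem theorem4p1:
  fixes scale :: "'k::field \<Rightarrow> 'v::ab_group_add \<Rightarrow> 'v"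
    and M W :: "bit \<Rightarrow> 'v set"
    and \<delta> \<mu> :: "'v cochain"
  assumes "CHAR('k) \<noteq> 2" and "CHAR('k) \<noteq> 3"
    and "graded_sum scale M W"
    and "\<delta> \<in> C_W scale M W 2" and "assoc_structure (grade M W) \<delta>"
    and "\<mu> \<in> C_MW scale M W 2 0" and "assoc_structure (grade M W) \<mu>"
  shows
    "equiv (inf_exts scale M W \<delta> \<mu>) (inf_equiv scale M W \<delta> \<mu>)
     \<and> (\<forall>lam \<psi> lam' \<psi>'.
          is_inf_ext scale M W \<delta> \<mu> lam \<psi> \<and> is_inf_ext scale M W \<delta> \<mu> lam' \<psi>' \<and>
          (inf_deform \<delta> \<mu> lam \<psi>, inf_deform \<delta> \<mu> lam' \<psi>') \<in> inf_equiv scale M W \<delta> \<mu> \<longrightarrow>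
          H_mu_class scale M W \<mu> 1 1 lam = H_mu_class scale M W \<mu> 1 1 lam')
     \<and> (\<forall>lam\<in>odd_Z_mu scale M W \<mu> 1 1. D M W \<delta> lam \<in> Z12_ker scale M W \<delta> \<mu>)
     \<and> (\<forall>lam\<in>odd_Z_mu scale M W \<mu> 1 1. \<forall>lam'\<in>odd_Z_mu scale M W \<mu> 1 1.
          H_mu_class scale M W \<mu> 1 1 lam = H_mu_class scale M W \<mu> 1 1 lam' \<longrightarrow>
          (H12_ker_class scale M W \<delta> \<mu> (D M W \<delta> lam) = H12_ker_class scale M W \<delta> \<mu> 0 \<longleftrightarrow>
           H12_ker_class scale M W \<delta> \<mu> (D M W \<delta> lam') = H12_ker_class scale M W \<delta> \<mu> 0))
     \<and> {H_mu_class scale M W \<mu> 1 1 lam | lam \<psi>. is_inf_ext scale M W \<delta> \<mu> lam \<psi>} =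
        {H_mu_class scale M W \<mu> 1 1 lam | lam. lam \<in> odd_Z_mu scale M W \<mu> 1 1 \<and>
           H12_ker_class scale M W \<delta> \<mu> (D M W \<delta> lam) = H12_ker_class scale M W \<delta> \<mu> 0}
     \<and> (\<forall>lam\<in>odd_Z_mu scale M W \<mu> 1 1.
          H12_ker_class scale M W \<delta> \<mu> (D M W \<delta> lam) = H12_ker_class scale M W \<delta> \<mu> 0 \<longrightarrow>
          (\<exists>\<psi>. is_inf_ext scale M W \<delta> \<mu> lam \<psi>) \<and>
          (\<forall>\<psi>. is_inf_ext scale M W \<delta> \<mu> lam \<psi> \<longrightarrow>
             (\<exists>F. bij_betw F (odd_H02 scale M W \<delta> \<mu>)
                    {inf_equiv scale M W \<delta> \<mu> `` {inf_deform \<delta> \<mu> lam' \<psi>'} | lam' \<psi>'.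
                       is_inf_ext scale M W \<delta> \<mu> lam' \<psi>' \<and>
                       H_mu_class scale M W \<mu> 1 1 lam' = H_mu_class scale M W \<mu> 1 1 lam} \<and>
                  (\<forall>\<tau>\<in>odd_reps02 scale M W \<delta> \<mu>.
                     is_inf_ext scale M W \<delta> \<mu> lam (\<psi> + \<tau>) \<and>
                     F (H02_class scale M W \<delta> \<mu> \<tau>) =
                       inf_equiv scale M W \<delta> \<mu> `` {inf_deform \<delta> \<mu> lam (\<psi> + \<tau>)}))))"
proof -
  interpret extension scale M W \<delta> \<mu>
    by (intro extension.intro graded_pair.intro extension_axioms.intro assms)
  have bij: "\<exists>F. bij_betw F (odd_H02 scale M W \<delta> \<mu>)
        {inf_equiv scale M W \<delta> \<mu> `` {inf_deform \<delta> \<mu> lam' \<psi>'} | lam' \<psi>'.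
           is_inf_ext scale M W \<delta> \<mu> lam' \<psi>' \<and>
           H_mu_class scale M W \<mu> 1 1 lam' = H_mu_class scale M W \<mu> 1 1 lam} \<and>
      (\<forall>\<tau>\<in>odd_reps02 scale M W \<delta> \<mu>.
         is_inf_ext scale M W \<delta> \<mu> lam (\<psi> + \<tau>) \<and>
         F (H02_class scale M W \<delta> \<mu> \<tau>) =
           inf_equiv scale M W \<delta> \<mu> `` {inf_deform \<delta> \<mu> lam (\<psi> + \<tau>)})"
    if ext: "is_inf_ext scale M W \<delta> \<mu> lam \<psi>" for lam \<psi>
    \<comment> \<open>Source and target are now both images of \<open>odd_reps02\<close>, under maps
      with the same fibres.\<close>
    unfolding odd_H02_def inf_ext_classes[OF ext]
    by (rule ex_forward[OF bij_betw_factor[OF H02_class_eq_iff_equiv[OF ext]]])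
       (simp_all add: is_inf_ext_add_reps[OF ext])
  have classes: "{H_mu_class scale M W \<mu> 1 1 lam | lam \<psi>. is_inf_ext scale M W \<delta> \<mu> lam \<psi>} =
        {H_mu_class scale M W \<mu> 1 1 lam | lam. lam \<in> odd_Z_mu scale M W \<mu> 1 1 \<and>
           H12_ker_class scale M W \<delta> \<mu> (D M W \<delta> lam) = H12_ker_class scale M W \<delta> \<mu> 0}"
    using obstruction_iff is_inf_ext_odd_Z by blast
  show ?thesis
    apply (intro conjI equiv_inf_equiv classes allI ballI impI)
    subgoal by (elim conjE) (rule inf_equiv_H11_class)
    subgoal by (rule D_\<delta>_odd_Z)
    subgoal by (rule iffI) (erule (3) obstruction_class, erule (1) obstruction_class, erule sym, assumption)
    subgoal by (simp only: obstruction_iff)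
    subgoal by (rule bij)
    done
qed

end
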